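(* For all $p,q,a,b,c\in\mathbb{N}$, the identity \begin{align*} \mathcal{S}_{F_0}(p,q,a,b,c;s) &=2(-1)^{p}\sum_{j=0}^{[p/2]}\zeta(2j)\sum_{\omega=0}^{p-2j}\binom{\omega+a-1}{\omega}\binom{p+c-2j-\omega-1}{c-1}\mathfrak{T}(q+a+\omega,s,p+b+c-2j-\omega;1,1)\\ &\ +2(-1)^{p+a}\sum_{j=0}^{[c/2]}\zeta(2j)\sum_{\omega=0}^{c-2j}\binom{\omega+a-1}{\omega}\binom{p+c-2j-\omega-1}{p-1}\mathfrak{T}(q,s+a+\omega,p+b+c-2j-\omega;1,1)\\ &\ +2(-1)^p\sum_{j=0}^{[a/2]}\zeta(2j)\sum_{\omega=0}^{p-1}\binom{\omega+a-2j}{\omega}\binom{p+c-2-\omega}{c-1}\mathfrak{T}(q+a-2j+\omega+1,s,p+b+c-1-\omega;1,1)\\ &\ +2(-1)^{p+a}\sum_{j=0}^{[a/2]}\zeta(2j)\sum_{\omega=0}^{c-1}\binom{\omega+a-2j}{\omega}\binom{p+c-2-\omega}{p-1}\mathfrak{T}(q,s+a-2j+\omega+1,p+b+c-\omega-1;1,1) \end{align*} holds for $s\in\mathbb{C}$ except for singularities of the functions on both sides, where $F_0(\mathbf{s})=\zeta_3(\mathbf{s};A_3)$.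
   Context: For $\mathbf{s}=(s_1,\dots,s_6)\in\mathbb{C}^6$, $\zeta_3(\mathbf{s};A_3)=\sum_{l,m,n=1}^\infty \frac{1}{l^{s_1}m^{s_2}n^{s_3}(l+m)^{s_4}(m+n)^{s_5}(l+m+n)^{s_6}}$, absolutely convergent for real parts sufficiently large and meromorphically continued to $\mathbb{C}^6$. For a function $F$ of six complex variables, $p,q,a,b,c\in\mathbb{N}$ and $s\in\mathbb{C}$, define $\mathcal{S}_F(p,q,a,b,c;s)=F(p,q,s,a,b,c)+(-1)^pF(p,a,s,q,c,b)+(-1)^{p+a}F(q,a,c,p,s,b)+(-1)^{p+a+c}F(q,s,c,b,a,p)+(-1)^{q}F(a,q,b,p,s,c)+(-1)^{q+b}F(a,s,b,c,q,p)+(-1)^{q+a}F(a,p,b,q,c,s)+(-1)^{q+a+b}F(a,c,b,s,p,q)+(-1)^{q+a+b+c}F(s,c,p,a,b,q)+(-1)^{p+q+a}F(q,p,c,a,b,s)+(-1)^{p+q+a+c}F(q,b,c,s,p,a)+(-1)^{p+q+a+b+c}F(s,b,p,q,c,a)$. $\zeta$ is the Riemann zeta-function (with $\zeta(0)=-1/2$). For $p,q\in\mathbb{N}$, $x,y\in\mathbb{C}$ with $|x|,|y|\le1$ and $s>1$, $\mathfrak{T}(p,s,q;x,y)=\sum_{l\in\mathbb{Z}\setminus\{0\},\,m\ge1,\,l+m\neq0}\frac{x^ly^m}{l^pm^s(l+m)^q}$, regarded as a meromorphic function of $s$. $[x]$ is the integer part; $\binom{x}{k}=x(x-1)\cdots(x-k+1)/k!$,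 $\binom{x}{0}=1$. *)

theory Defs
  imports "HOL-Complex_Analysis.Complex_Analysis"
begin

(* Several complex variables: a function on C^n is holomorphic on an open set iff it is
   Frechet differentiable there with complex-linear derivative. *)

definition cvec_holomorphic_on :: "(complex ^ 'n \<Rightarrow> complex) \<Rightarrow> (complex ^ 'n) set \<Rightarrow> bool" where
  "cvec_holomorphic_on f U \<longleftrightarrow>
     (\<forall>z\<in>U. \<exists>D. (f has_derivative D) (at z) \<and> (\<forall>c v. D (c *s v) = c * D v))"

(* "z is not a singularity of f" *)
definition cvec_analytic_at :: "(complex ^ 'n \<Rightarrow> complex) \<Rightarrow> complex ^ 'n \<Rightarrow> bool" where
  "cvec_analytic_at f z \<longleftrightarrow> (\<exists>r>0. cvec_holomorphic_on f (ball z r))"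

(* Meromorphic on C^n: locally a quotient g / h of holomorphic functions, h not identically zero.
   As functions are total, the values on the zero set of h are left unspecified, as they are on
   the poles in the one-variable meromorphic_on. *)
definition cvec_meromorphic :: "(complex ^ 'n \<Rightarrow> complex) \<Rightarrow> bool" where
  "cvec_meromorphic f \<longleftrightarrow>
     (\<forall>z. \<exists>r>0. \<exists>g h.
        cvec_holomorphic_on g (ball z r) \<and> cvec_holomorphic_on h (ball z r) \<and>
        (\<exists>w\<in>ball z r. h w \<noteq> 0) \<and>
        (\<forall>w\<in>ball z r. h w \<noteq> 0 \<longrightarrow> f w = g w / h w))"

lemma vector_6 [simp]:
  "(vector [x1, x2, x3, x4, x5, x6] :: ('a::zero) ^ 6) $ 1 = x1"
  "(vector [x1, x2, x3, x4, x5, x6] :: ('a::zero) ^ 6) $ 2 = x2"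
  "(vector [x1, x2, x3, x4, x5, x6] :: ('a::zero) ^ 6) $ 3 = x3"
  "(vector [x1, x2, x3, x4, x5, x6] :: ('a::zero) ^ 6) $ 4 = x4"
  "(vector [x1, x2, x3, x4, x5, x6] :: ('a::zero) ^ 6) $ 5 = x5"
  "(vector [x1, x2, x3, x4, x5, x6] :: ('a::zero) ^ 6) $ 6 = x6"
  unfolding vector_def by simp_all

definition A3_term :: "complex ^ 6 \<Rightarrow> nat \<times> nat \<times> nat \<Rightarrow> complex" where
  "A3_term z = (\<lambda>(l, m, n).
     1 / (of_nat l powr (z $ 1) * of_nat m powr (z $ 2) * of_nat n powr (z $ 3) *
          of_nat (l + m) powr (z $ 4) * of_nat (m + n) powr (z $ 5) *
          of_nat (l + m + n) powr (z $ 6)))"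

definition zeta3_A3_continuation :: "(complex ^ 6 \<Rightarrow> complex) \<Rightarrow> bool" where
  "zeta3_A3_continuation F \<longleftrightarrow>
     cvec_meromorphic F \<and>
     (\<forall>z. (\<lambda>x. norm (A3_term z x)) summable_on ({1..} \<times> {1..} \<times> {1..}) \<longrightarrow>
          F z = (\<Sum>\<^sub>\<infinity>x\<in>{1..} \<times> {1..} \<times> {1..}. A3_term z x))"

definition T_sum :: "nat \<Rightarrow> complex \<Rightarrow> nat \<Rightarrow> complex \<Rightarrow> complex \<Rightarrow> complex" where
  "T_sum p s q x y =
     (\<Sum>\<^sub>\<infinity>(l, m)\<in>{(l :: int, m :: nat). l \<noteq> 0 \<and> 1 \<le> m \<and> l + int m \<noteq> 0}.
        (x powi l * y ^ m) / (of_int l ^ p * of_nat m powr s * of_int (l + int m) ^ q))"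

definition T_continuation ::
  "(nat \<Rightarrow> complex \<Rightarrow> nat \<Rightarrow> complex \<Rightarrow> complex \<Rightarrow> complex) \<Rightarrow> complex \<Rightarrow> complex \<Rightarrow> bool" where
  "T_continuation T x y \<longleftrightarrow>
     (\<forall>p\<ge>1. \<forall>q\<ge>1. (\<lambda>s. T p s q x y) meromorphic_on UNIV \<and>
        (\<forall>s. Re s > 1 \<longrightarrow> T p s q x y = T_sum p s q x y))"

(* Outside the half-plane of convergence the continuation is given by Hasse's series
   1/(s-1) * sum_n 1/(n+1) * sum_{k<=n} (-1)^k (n choose k) (k+1)^(1-s), which converges
   for every s other than 1. *)
definition riemann_zeta :: "complex \<Rightarrow> complex" where
  "riemann_zeta s =
     (if Re s > 1 then (\<Sum>n. 1 / of_nat (Suc n) powr s)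
      else 1 / (s - 1) * (\<Sum>n. 1 / of_nat (Suc n) *
             (\<Sum>k\<le>n. (-1) ^ k * of_nat (n choose k) * of_nat (Suc k) powr (1 - s))))"

lemma riemann_zeta_0: "riemann_zeta 0 = - 1 / 2"
proof -
  define h :: "nat \<Rightarrow> complex"
    where "h n = (\<Sum>k\<le>n. (-1) ^ k * of_nat (n choose k) * of_nat (Suc k))" for n
  have h: "h n = 0" if "n \<ge> 2" for n
  proof -
    have "h n = (\<Sum>k\<le>n. (-1) ^ k * of_nat k * of_nat (n choose k))
              + (\<Sum>k\<le>n. (-1) ^ k * of_nat (n choose k))"
      unfolding h_def sum.distrib [symmetric] by (intro sum.cong) (auto simp: algebra_simps)
    also have "\<dots> = 0"
      using that choose_alternating_linear_sum [of n, where 'a = complex]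
        choose_alternating_sum [of n, where 'a = complex] by simp
    finally show ?thesis .
  qed
  have "(\<Sum>n. 1 / of_nat (Suc n) * h n) = (\<Sum>n<2. 1 / of_nat (Suc n) * h n)"
    by (intro suminf_finite) (auto simp: h)
  also have "\<dots> = 1 / 2"
    by (simp add: h_def eval_nat_numeral)
  finally show ?thesis
    by (simp add: riemann_zeta_def h_def del: of_nat_Suc)
qed

(* The pairs (k, z) stand for the summands (-1)^k F(z) of S_sum. *)
definition S_terms ::
  "nat \<Rightarrow> nat \<Rightarrow> nat \<Rightarrow> nat \<Rightarrow> nat \<Rightarrow> complex \<Rightarrow> (nat \<times> (complex ^ 6)) list" where
  "S_terms p' q' a' b' c' s =
     (let p = of_nat p'; q = of_nat q'; a = of_nat a'; b = of_nat b'; c = of_nat c' in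
      [(0,                     vector [p, q, s, a, b, c]),
       (p',                    vector [p, a, s, q, c, b]),
       (p' + a',               vector [q, a, c, p, s, b]),
       (p' + a' + c',          vector [q, s, c, b, a, p]),
       (q',                    vector [a, q, b, p, s, c]),
       (q' + b',               vector [a, s, b, c, q, p]),
       (q' + a',               vector [a, p, b, q, c, s]),
       (q' + a' + b',          vector [a, c, b, s, p, q]),
       (q' + a' + b' + c',     vector [s, c, p, a, b, q]),
       (p' + q' + a',          vector [q, p, c, a, b, s]),
       (p' + q' + a' + c',     vector [q, b, c, s, p, a]),
       (p' + q' + a' + b' + c', vector [s, b, p, q, c, a])])"

definition S_sum ::
  "(complex ^ 6 \<Rightarrow> complex) \<Rightarrow> nat \<Rightarrow> nat \<Rightarrow> nat \<Rightarrow> nat \<Rightarrow> nat \<Rightarrow> complex \<Rightarrow> complex" where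
  "S_sum F p q a b c s = (\<Sum>(k, z)\<leftarrow>S_terms p q a b c s. (-1) ^ k * F z)"

end

theory Submission
  imports Defs
begin

text \<open>
  For \<open>Re s > 1\<close>, let \<open>(l, m, n)\<close> run over all integers with \<open>n > 0\<close> at which the six positive roots
  \<open>l\<close>, \<open>m\<close>, \<open>n\<close>, \<open>l + m\<close>, \<open>m + n\<close>, \<open>l + m + n\<close> do not vanish, and sum the product of their inverse powers.
  The hyperplanes cut this region into twelve Weyl chambers, each of which contributes one summand of
  \<open>S_sum\<close>. Summing over \<open>l\<close> first instead, the inner sum is that of a rational function with the three
  poles \<open>0\<close>, \<open>-m\<close>, \<open>-(m + n)\<close>; partial fractions turn it into even zeta values, and the
  remaining double sums are values of \<open>T_sum\<close>.

  Analytic continuation in \<open>s\<close> takes place on lines in \<open>\<complex>\<^sup>6\<close>, along which the local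
  denominators of a meromorphic function of six variables may vanish identically. The function is
  therefore approached from a generic transversal direction \<open>v\<close>: its limit as \<open>t \<rightarrow> 0\<close> along
  \<open>z + u e + t v\<close> is meromorphic in \<open>u\<close> as soon as it is finite somewhere, because the order in \<open>t\<close>
  is the same for all \<open>u\<close> outside a discrete set.
\<close>

section \<open>Meromorphic functions restricted to lines\<close>

text \<open>Only \<open>n\<close> carries the complex exponent, hence the condition
  \<open>n > 0\<close>, which keeps half of the 24 chambers. Exponents equal to 1 are the delicate
  case: partial fractions would split an absolutely convergent sum over \<open>l\<close> into
  divergent sums of \<open>1 / l\<close>. This splitting is avoided: the sums and the closed formula
  satisfy the same recurrence, which is stopped at exponents whose sums still converge. Each integer
  excluded as a pole costs one term, and zeta(0) = -1/2 is exactly the value that absorbs this cost.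
  In the continuation, \<open>F\<close> itself need not be meromorphic along a line, because a local
  quotient \<open>g / h\<close> prescribes nothing where \<open>h = 0\<close>. What is available is
  continuity where all real parts are at least 1, and analyticity at the twelve points belonging to
  \<open>s\<close>. So for each line a meromorphic function of \<open>u\<close> is constructed that
  takes the values of \<open>F\<close> wherever \<open>F\<close> is continuous.\<close>

lemma power_factor_bound:
  fixes \<psi> :: "complex \<Rightarrow> complex"
  assumes hol: "\<psi> holomorphic_on ball 0 d" and R: "0 < R" "R < d"
    and M: "\<And>t. norm t = R \<Longrightarrow> norm (t ^ k * \<psi> t) \<le> M" and t: "norm t \<le> R"
  shows "norm (\<psi> t) \<le> M / R ^ k"
\<comment> \<open>Dividing by \<open>t ^ k\<close> costs exactly \<open>R ^ k\<close> on the circle,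
  and the maximum principle carries the bound inside, past \<open>t = 0\<close>, where division is
  impossible.\<close>
proof (rule maximum_modulus_frontier[of \<psi> "cball 0 R"])
  show "\<psi> holomorphic_on interior (cball 0 R)"
    using hol by (rule holomorphic_on_subset) (use R in auto)
  show "continuous_on (closure (cball 0 R)) \<psi>"
    using holomorphic_on_imp_continuous_on[OF hol] by (rule continuous_on_subset) (use R in auto)
  show "norm (\<psi> z) \<le> M / R ^ k" if "z \<in> frontier (cball 0 R)" for z
    using M[of z] that R by (auto simp: norm_mult norm_power field_simps)
qed (use t R in auto)

text \<open>
  Extracts the lowest power of \<open>t\<close>. The coefficient is holomorphic by Montel's theorem, so no
  differentiability beyond separate holomorphy is needed.
\<close>

lemma leading_coefficient:
  fixes \<Phi> :: "complex \<Rightarrow> complex \<Rightarrow> complex"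
  assumes cont: "continuous_on (ball 0 d \<times> ball u0 d) (\<lambda>(t, u). \<Phi> t u)"
    and holt: "\<And>u. u \<in> ball u0 d \<Longrightarrow> (\<lambda>t. \<Phi> t u) holomorphic_on ball 0 d"
    and holu: "\<And>t. t \<in> ball 0 d \<Longrightarrow> (\<lambda>u. \<Phi> t u) holomorphic_on ball u0 d"
    and nz: "t1 \<in> ball 0 d" "u1 \<in> ball u0 d" "\<Phi> t1 u1 \<noteq> 0"
  obtains k \<alpha> where "\<alpha> holomorphic_on ball u0 d" "\<exists>u\<in>ball u0 d. \<alpha> u \<noteq> 0"
    "\<And>u. u \<in> ball u0 d \<Longrightarrow> (\<lambda>t. \<Phi> t u / t ^ k) \<midarrow>0\<rightarrow> \<alpha> u"
proof -
  \<comment> \<open>Divisibility by \<open>t ^ k\<close> for all \<open>u\<close> at once. With the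
    order taken uniformly, the coefficient may vanish at some \<open>u\<close>, but not at all of
    them.\<close>
  define D where "D k \<longleftrightarrow> (\<forall>u\<in>ball u0 d. \<exists>\<psi>. \<psi> holomorphic_on ball 0 d \<and>
    (\<forall>t\<in>ball 0 d. \<Phi> t u = t ^ k * \<psi> t))" for k
  have d: "d > 0" using nz(1) by (auto intro: le_less_trans[OF norm_ge_zero])
  have D0: "D 0" unfolding D_def
  proof
    show "\<exists>\<psi>. \<psi> holomorphic_on ball 0 d \<and> (\<forall>t\<in>ball 0 d. \<Phi> t u = t ^ 0 * \<psi> t)" if "u \<in> ball u0 d" for u
      using holt[OF that] by (intro exI[of _ "\<lambda>t. \<Phi> t u"]) simp
  qed
  have "\<exists>k. \<not> D k"
  proof (rule ccontr)
    assume "\<not> ?thesis"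
    hence Dk: "D k" for k by auto
    \<comment> \<open>Any \<open>R\<close> strictly between \<open>norm t1\<close> and
      \<open>d\<close> serves: if every power of \<open>t\<close> divided, the value at
      \<open>(t1, u1)\<close> would be bounded by \<open>M * (norm t1 / R) ^ k\<close> for all
      \<open>k\<close>, hence be 0.\<close>
    define R where "R = (norm t1 + d) / 2"
    have R: "norm t1 < R" "R < d" "R > 0" using nz(1) d by (auto simp: R_def add_pos_nonneg add_nonneg_pos)
    have "compact ((\<lambda>t. \<Phi> t u1) ` cball 0 R)"
      using R by (intro compact_continuous_image continuous_on_subset[OF holomorphic_on_imp_continuous_on[OF holt[OF nz(2)]]]) auto
    then obtain M where M: "\<And>t. norm t \<le> R \<Longrightarrow> norm (\<Phi> t u1) \<le> M"
      by (fastforce dest!: compact_imp_bounded simp: bounded_iff)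
    have bd: "norm (\<Phi> t1 u1) \<le> M * (norm t1 / R) ^ k" for k
    proof -
      obtain \<psi> where \<psi>: "\<psi> holomorphic_on ball 0 d" "\<And>t. t \<in> ball 0 d \<Longrightarrow> \<Phi> t u1 = t ^ k * \<psi> t"
        using Dk[of k] nz(2) unfolding D_def by blast
      have "norm (\<psi> t1) \<le> M / R ^ k"
      proof (rule power_factor_bound[OF \<psi>(1) \<open>R>0\<close> \<open>R<d\<close>])
        show "norm (t ^ k * \<psi> t) \<le> M" if "norm t = R" for t
          using M[of t] \<psi>(2)[of t] that R by simp
      qed (use R in simp)
      hence "norm t1 ^ k * norm (\<psi> t1) \<le> norm t1 ^ k * (M / R ^ k)" by (intro mult_left_mono) auto
      thus ?thesis using \<psi>(2)[OF nz(1)] by (simp add: norm_mult norm_power field_simps)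
    qed
    have "(\<lambda>k. M * (norm t1 / R) ^ k) \<longlonglongrightarrow> M * 0"
      using R by (intro tendsto_intros LIMSEQ_realpow_zero) auto
    hence "norm (\<Phi> t1 u1) \<le> M * 0" using bd by (intro LIMSEQ_le_const) auto
    thus False using nz by simp
  qed
  define k where "k = (LEAST k. \<not> D k) - 1"
  have "\<not> D (LEAST k. \<not> D k)" using \<open>\<exists>k. \<not> D k\<close> by (rule LeastI_ex)
  moreover have "(LEAST k. \<not> D k) \<noteq> 0" using calculation D0 by (intro notI) auto
  ultimately have nDk: "\<not> D (Suc k)" and Dk: "D k"
    using not_less_Least[of k "\<lambda>k. \<not> D k"] unfolding k_def by auto
  obtain \<psi> where \<psi>: "\<And>u. u \<in> ball u0 d \<Longrightarrow> \<psi> u holomorphic_on ball 0 d"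
    "\<And>u t. u \<in> ball u0 d \<Longrightarrow> t \<in> ball 0 d \<Longrightarrow> \<Phi> t u = t ^ k * \<psi> u t"
    using Dk unfolding D_def by metis
  define \<alpha> where "\<alpha> u = \<psi> u 0" for u
  have lim: "(\<lambda>t. \<Phi> t u / t ^ k) \<midarrow>0\<rightarrow> \<alpha> u" if u: "u \<in> ball u0 d" for u
  proof -
    have "isCont (\<psi> u) 0" using holomorphic_on_imp_continuous_on[OF \<psi>(1)[OF u]] d
      by (simp add: continuous_on_eq_continuous_at)
    hence "\<psi> u \<midarrow>0\<rightarrow> \<alpha> u" by (simp add: isCont_def \<alpha>_def)
    moreover have "eventually (\<lambda>t. t \<in> ball 0 d - {0}) (at (0::complex))"
      by (rule eventually_at_in_open) (use d in auto)
    hence "eventually (\<lambda>t. \<psi> u t = \<Phi> t u / t ^ k) (at 0)"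
      by eventually_elim (use \<psi>(2)[OF u] in auto)
    ultimately show ?thesis by (rule Lim_transform_eventually)
  qed
  have nza: "\<exists>u\<in>ball u0 d. \<alpha> u \<noteq> 0"
  proof (rule ccontr)
    assume "\<not> ?thesis"
    hence z: "\<psi> u 0 = 0" if "u \<in> ball u0 d" for u using that by (auto simp: \<alpha>_def)
    \<comment> \<open>If the coefficient vanished identically, every \<open>\<psi> u\<close> would
      have a zero at 0 and give up one more factor \<open>t\<close>, against the choice of
      \<open>k\<close>.\<close>
    have "D (Suc k)" unfolding D_def
    proof
      fix u assume u: "u \<in> ball u0 d"
      let ?\<chi> = "\<lambda>t. if t = 0 then deriv (\<psi> u) 0 else (\<psi> u t - \<psi> u 0) / (t - 0)"
      have "?\<chi> holomorphic_on ball 0 d" by (rule pole_lemma_open[OF \<psi>(1)[OF u]]) auto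
      moreover have "\<Phi> t u = t ^ Suc k * ?\<chi> t" if "t \<in> ball 0 d" for t
        using \<psi>(2)[OF u that] z[OF u] by auto
      ultimately show "\<exists>\<psi>. \<psi> holomorphic_on ball 0 d \<and> (\<forall>t\<in>ball 0 d. \<Phi> t u = t ^ Suc k * \<psi> t)"
        by blast
    qed
    thus False using nDk by simp
  qed
  have "\<alpha> holomorphic_on ball u0 d"
  proof -
    \<comment> \<open>Holomorphy in \<open>u\<close> is known only for \<open>t \<noteq> 0\<close>,
      where \<open>\<psi> u t\<close> is \<open>\<Phi> t u / t ^ k\<close>. So
      \<open>\<alpha>\<close> is reached through sample points tending to 0; the bound on the factor
      makes the samples locally bounded in \<open>u\<close>.\<close>
    define \<F> where "\<F> n u = \<psi> u (of_real (d / 2) / of_nat (Suc n))" for n :: nat and u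
    have tn: "norm (complex_of_real (d / 2) / of_nat (Suc n)) \<le> d / 2" for n
      using d by (auto simp: norm_divide field_simps simp del: of_nat_Suc)
    have tn0: "complex_of_real (d / 2) / of_nat (Suc n) \<noteq> 0" for n using d by (auto simp del: of_nat_Suc)
    have tnb: "complex_of_real (d / 2) / of_nat (Suc n) \<in> ball 0 d" for n
      using tn[of n] d by (auto simp del: of_nat_Suc)
    have hF: "\<F> n holomorphic_on ball u0 d" for n
    proof -
      let ?t = "complex_of_real (d / 2) / of_nat (Suc n)"
      have "(\<lambda>u. \<Phi> ?t u / ?t ^ k) holomorphic_on ball u0 d"
        using holu[OF tnb] tn0[of n] by (intro holomorphic_intros) auto
      thus ?thesis
        by (rule holomorphic_transform) (use \<psi>(2)[OF _ tnb] tn0[of n] in \<open>auto simp: \<F>_def simp del: of_nat_Suc\<close>)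
    qed
    have bd: "\<exists>B. \<forall>h\<in>range \<F>. \<forall>z\<in>K. norm (h z) \<le> B" if K: "compact K" "K \<subseteq> ball u0 d" for K
    proof -
      have "compact ((\<lambda>(t, u). \<Phi> t u) ` (cball 0 (d/2) \<times> K))"
        using d K by (intro compact_continuous_image continuous_on_subset[OF cont] compact_Times) auto
      then obtain M where M: "\<And>t u. norm t \<le> d/2 \<Longrightarrow> u \<in> K \<Longrightarrow> norm (\<Phi> t u) \<le> M"
        by (fastforce dest!: compact_imp_bounded simp: bounded_iff)
      have "norm (\<F> n z) \<le> M / (d/2)^k" if z: "z \<in> K" for n z
        unfolding \<F>_def
      proof (rule power_factor_bound[OF \<psi>(1), of z "d/2"])
        show "norm (t ^ k * \<psi> z t) \<le> M" if "norm t = d / 2" for t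
          using M[of t z] z \<psi>(2)[of z t] K that d by auto
      qed (use z K d tn in auto)
      thus ?thesis by auto
    qed
    obtain g r where g: "g holomorphic_on ball u0 d" "strict_mono (r :: nat \<Rightarrow> nat)"
      "\<And>x. x \<in> ball u0 d \<Longrightarrow> (\<lambda>n. \<F> (r n) x) \<longlonglongrightarrow> g x"
      by (rule Montel[of "ball u0 d" "range \<F>" \<F>]) (use bd hF in auto)
    have "\<alpha> u = g u" if u: "u \<in> ball u0 d" for u
    proof -
      have "isCont (\<psi> u) 0" using holomorphic_on_imp_continuous_on[OF \<psi>(1)[OF u]] d
        by (simp add: continuous_on_eq_continuous_at)
      moreover have "(\<lambda>n. complex_of_real (d / 2) * (1 / of_nat (Suc n))) \<longlonglongrightarrow> of_real (d / 2) * 0"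
        by (intro tendsto_intros LIMSEQ_Suc[OF lim_1_over_n])
      hence "(\<lambda>n. complex_of_real (d / 2) / of_nat (Suc n)) \<longlonglongrightarrow> 0" by simp
      ultimately have "(\<lambda>n. \<F> n u) \<longlonglongrightarrow> \<alpha> u"
        unfolding \<F>_def \<alpha>_def by (rule isCont_tendsto_compose)
      hence "(\<lambda>n. \<F> (r n) u) \<longlonglongrightarrow> \<alpha> u" using g(2) by (rule LIMSEQ_subseq_LIMSEQ[unfolded o_def])
      thus ?thesis using g(3)[OF u] LIMSEQ_unique by blast
    qed
    thus ?thesis using g(1) holomorphic_transform by metis
  qed
  thus ?thesis using that lim nza by blast
qed

lemma nonzero_holomorphic_dense:
  assumes "\<alpha> holomorphic_on ball (u0::complex) d" "u1 \<in> ball u0 d" "\<alpha> u1 \<noteq> 0"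
    and "open V" "V \<noteq> {}" "V \<subseteq> ball u0 d"
  obtains u where "u \<in> V" "\<alpha> u \<noteq> 0"
proof -
  have "\<exists>u\<in>V. \<alpha> u \<noteq> 0"
  proof (rule ccontr)
    assume "\<not> ?thesis"
    hence "\<alpha> u1 = 0"
      using analytic_continuation_open[of V "ball u0 d" \<alpha> "\<lambda>_. 0" u1] assms by auto
    thus False using assms by simp
  qed
  thus ?thesis using that by blast
qed

text \<open>If \<open>h\<close> and \<open>g\<close> have leading terms
  \<open>\<alpha> u * t ^ k\<close> and \<open>\<beta> u * t ^ j\<close>, the quotient behaves like
  \<open>t ^ (j - k) * \<beta> u / \<alpha> u\<close> with an integer exponent. Whether it converges
  or blows up is decided by \<open>j\<close> and \<open>k\<close> alone, hence alike for all
  \<open>u\<close> off the zeros of \<open>\<alpha>\<close> and \<open>\<beta>\<close>.\<close>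

lemma quotient_limit:
  fixes g h F :: "complex \<Rightarrow> complex \<Rightarrow> complex"
  assumes contg: "continuous_on (ball 0 d \<times> ball u0 d) (\<lambda>(t, u). g t u)"
    and gt: "\<And>u. u \<in> ball u0 d \<Longrightarrow> (\<lambda>t. g t u) holomorphic_on ball 0 d"
    and gu: "\<And>t. t \<in> ball 0 d \<Longrightarrow> (\<lambda>u. g t u) holomorphic_on ball u0 d"
    and conth: "continuous_on (ball 0 d \<times> ball u0 d) (\<lambda>(t, u). h t u)"
    and ht: "\<And>u. u \<in> ball u0 d \<Longrightarrow> (\<lambda>t. h t u) holomorphic_on ball 0 d"
    and hu: "\<And>t. t \<in> ball 0 d \<Longrightarrow> (\<lambda>u. h t u) holomorphic_on ball u0 d"
    and F: "\<And>t u. t \<in> ball 0 d \<Longrightarrow> u \<in> ball u0 d \<Longrightarrow> h t u \<noteq> 0 \<Longrightarrow> F t u = g t u / h t u"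
    and nz: "t1 \<in> ball 0 d" "u1 \<in> ball u0 d" "h t1 u1 \<noteq> 0"
  obtains \<alpha> \<beta> where "\<alpha> holomorphic_on ball u0 d" "\<beta> holomorphic_on ball u0 d" "\<exists>u\<in>ball u0 d. \<alpha> u \<noteq> 0"
    "(\<forall>u\<in>ball u0 d. \<alpha> u \<noteq> 0 \<longrightarrow> (\<lambda>t. F t u) \<midarrow>0\<rightarrow> \<beta> u / \<alpha> u) \<or>
     (\<exists>u\<in>ball u0 d. \<beta> u \<noteq> 0) \<and>
     (\<forall>u\<in>ball u0 d. \<alpha> u \<noteq> 0 \<and> \<beta> u \<noteq> 0 \<longrightarrow> filterlim (\<lambda>t. F t u) at_infinity (at 0))"
proof -
  have d: "d > 0" using nz(1) by (auto intro: le_less_trans[OF norm_ge_zero])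
  obtain k \<alpha> where \<alpha>: "\<alpha> holomorphic_on ball u0 d" "\<exists>u\<in>ball u0 d. \<alpha> u \<noteq> 0"
    "\<And>u. u \<in> ball u0 d \<Longrightarrow> (\<lambda>t. h t u / t ^ k) \<midarrow>0\<rightarrow> \<alpha> u"
    by (rule leading_coefficient[OF conth ht hu nz]) auto
  have evb: "eventually (\<lambda>t. t \<in> ball 0 d \<and> t \<noteq> 0) (at (0::complex))"
    using eventually_at_in_open[of "ball 0 d" "0::complex"] d by auto
  have evF: "eventually (\<lambda>t. h t u \<noteq> 0 \<and> F t u = g t u / h t u) (at 0)"
    if u: "u \<in> ball u0 d" "\<alpha> u \<noteq> 0" for u
  proof -
    have "eventually (\<lambda>t. h t u / t ^ k \<noteq> 0) (at 0)"
      by (rule tendsto_imp_eventually_ne[OF \<alpha>(3)[OF u(1)] u(2)])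
    thus ?thesis using evb by eventually_elim (use F u in auto)
  qed
  show thesis
  proof (cases "\<exists>t\<in>ball 0 d. \<exists>u\<in>ball u0 d. g t u \<noteq> 0")
    \<comment> \<open>Here \<open>g\<close> vanishes identically and has no leading
      coefficient.\<close>
    case False
    have "(\<lambda>t. F t u) \<midarrow>0\<rightarrow> 0 / \<alpha> u" if u: "u \<in> ball u0 d" "\<alpha> u \<noteq> 0" for u
    proof (rule Lim_transform_eventually)
      show "(\<lambda>t. 0 / \<alpha> u) \<midarrow>0\<rightarrow> 0 / \<alpha> u" by simp
      show "eventually (\<lambda>t. 0 / \<alpha> u = F t u) (at 0)"
        using evF[OF u] evb by eventually_elim (use False u in auto)
    qed
    thus thesis using that[of \<alpha> "\<lambda>_. 0"] \<alpha> by auto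
  next
    case True
    then obtain t2 u2 where nz2: "t2 \<in> ball 0 d" "u2 \<in> ball u0 d" "g t2 u2 \<noteq> 0" by blast
    obtain j \<beta> where \<beta>: "\<beta> holomorphic_on ball u0 d" "\<exists>u\<in>ball u0 d. \<beta> u \<noteq> 0"
      "\<And>u. u \<in> ball u0 d \<Longrightarrow> (\<lambda>t. g t u / t ^ j) \<midarrow>0\<rightarrow> \<beta> u"
      by (rule leading_coefficient[OF contg gt gu nz2]) auto
    have q: "(\<lambda>t. (g t u / t ^ j) / (h t u / t ^ k)) \<midarrow>0\<rightarrow> \<beta> u / \<alpha> u"
      if u: "u \<in> ball u0 d" "\<alpha> u \<noteq> 0" for u
      by (intro tendsto_divide \<beta>(3) \<alpha>(3) u)
    show thesis
    proof (cases "k \<le> j")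
      case True
      \<comment> \<open>The factor \<open>0 ^ (j - k)\<close> is 1 for \<open>j = k\<close> and 0
        for \<open>j > k\<close>, so one formula covers both cases.\<close>
      have "(\<lambda>t. F t u) \<midarrow>0\<rightarrow> (0 ^ (j - k) * \<beta> u) / \<alpha> u" if u: "u \<in> ball u0 d" "\<alpha> u \<noteq> 0" for u
      proof (rule Lim_transform_eventually)
        have "(\<lambda>t. t ^ (j - k) * ((g t u / t ^ j) / (h t u / t ^ k))) \<midarrow>0\<rightarrow> 0 ^ (j - k) * (\<beta> u / \<alpha> u)"
          by (intro tendsto_intros q u)
        thus "(\<lambda>t. t ^ (j - k) * ((g t u / t ^ j) / (h t u / t ^ k))) \<midarrow>0\<rightarrow> (0 ^ (j - k) * \<beta> u) / \<alpha> u"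
          by simp
        show "eventually (\<lambda>t. t ^ (j - k) * ((g t u / t ^ j) / (h t u / t ^ k)) = F t u) (at 0)"
          using evF[OF u] evb by eventually_elim (use True in \<open>simp add: power_diff field_simps\<close>)
      qed
      moreover have "(\<lambda>u. 0 ^ (j - k) * \<beta> u) holomorphic_on ball u0 d"
        by (intro holomorphic_intros \<beta>)
      ultimately show thesis using that[of \<alpha> "\<lambda>u. 0 ^ (j - k) * \<beta> u"] \<alpha> by auto
    next
      case False
      have "filterlim (\<lambda>t. F t u) at_infinity (at 0)" if u: "u \<in> ball u0 d" "\<alpha> u \<noteq> 0" "\<beta> u \<noteq> 0" for u
      proof -
        have "((\<lambda>t::complex. t ^ (k - j)) \<longlongrightarrow> 0 ^ (k - j)) (at 0)" by (intro tendsto_intros)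
        hence "filterlim (\<lambda>t::complex. t ^ (k - j)) (at 0) (at 0)"
          using False by (intro filterlim_atI) (auto simp: eventually_at_filter power_0_left)
        hence "filterlim (\<lambda>t. ((g t u / t ^ j) / (h t u / t ^ k)) / t ^ (k - j)) at_infinity (at 0)"
          using u by (intro filterlim_divide_at_infinity[OF q]) auto
        moreover have "eventually (\<lambda>t. ((g t u / t ^ j) / (h t u / t ^ k)) / t ^ (k - j) = F t u) (at 0)"
          using evF[OF u(1,2)] evb by eventually_elim (use False in \<open>simp add: power_diff field_simps\<close>)
        ultimately show ?thesis by (rule filterlim_cong[OF refl refl, THEN iffD1, rotated])
      qed
      thus thesis using that[of \<alpha> \<beta>] \<alpha> \<beta> by auto
    qed
  qed
qed

text \<open>
  The set of points near which the limit exists on a dense set is open and closed: where the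
  limit is infinite off a discrete set, it cannot be finite on a dense subset of an open set.
\<close>

lemma iterated_limit_meromorphic:
  fixes F :: "complex \<Rightarrow> complex \<Rightarrow> complex"
  assumes loc: "\<And>u0. \<exists>c d \<alpha> \<beta>. u0 \<in> ball c d \<and> \<alpha> holomorphic_on ball c d \<and> \<beta> holomorphic_on ball c d \<and> (\<exists>u\<in>ball c d. \<alpha> u \<noteq> 0) \<and>
      ((\<forall>u\<in>ball c d. \<alpha> u \<noteq> 0 \<longrightarrow> (\<lambda>t. F t u) \<midarrow>0\<rightarrow> \<beta> u / \<alpha> u) \<or>
     (\<exists>u\<in>ball c d. \<beta> u \<noteq> 0) \<and>
     (\<forall>u\<in>ball c d. \<alpha> u \<noteq> 0 \<and> \<beta> u \<noteq> 0 \<longrightarrow> filterlim (\<lambda>t. F t u) at_infinity (at 0)))"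
    and U: "open U" "U \<noteq> {}" "\<And>u. u \<in> U \<Longrightarrow> \<exists>L. (\<lambda>t. F t u) \<midarrow>0\<rightarrow> L"
  shows "(\<lambda>u. Lim (at 0) (\<lambda>t. F t u)) meromorphic_on UNIV"
proof -
  define W where "W = {u. \<exists>L. (\<lambda>t. F t u) \<midarrow>0\<rightarrow> L}"
  \<comment> \<open>\<open>W\<close> may miss isolated points, so it need not be open or closed. The
    interior of its closure ignores such gaps.\<close>
  define A where "A = interior (closure W)"
  have key: "\<exists>c d \<alpha> \<beta>. u0 \<in> ball c d \<and> \<alpha> holomorphic_on ball c d \<and> \<beta> holomorphic_on ball c d \<and> (\<exists>u\<in>ball c d. \<alpha> u \<noteq> 0) \<and>
      (\<forall>u\<in>ball c d. \<alpha> u \<noteq> 0 \<longrightarrow> (\<lambda>t. F t u) \<midarrow>0\<rightarrow> \<beta> u / \<alpha> u)" if u0: "u0 \<in> closure A" for u0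
  proof -
    obtain c d \<alpha> \<beta> where *: "u0 \<in> ball c d" "\<alpha> holomorphic_on ball c d" "\<beta> holomorphic_on ball c d"
      "\<exists>u\<in>ball c d. \<alpha> u \<noteq> 0"
      "(\<forall>u\<in>ball c d. \<alpha> u \<noteq> 0 \<longrightarrow> (\<lambda>t. F t u) \<midarrow>0\<rightarrow> \<beta> u / \<alpha> u) \<or>
     (\<exists>u\<in>ball c d. \<beta> u \<noteq> 0) \<and>
     (\<forall>u\<in>ball c d. \<alpha> u \<noteq> 0 \<and> \<beta> u \<noteq> 0 \<longrightarrow> filterlim (\<lambda>t. F t u) at_infinity (at 0))"
      using loc[of u0] by blast
    have "\<not> ((\<exists>u\<in>ball c d. \<beta> u \<noteq> 0) \<and>
     (\<forall>u\<in>ball c d. \<alpha> u \<noteq> 0 \<and> \<beta> u \<noteq> 0 \<longrightarrow> filterlim (\<lambda>t. F t u) at_infinity (at 0)))"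
    proof (intro notI, elim conjE)
      assume \<beta>: "\<exists>u\<in>ball c d. \<beta> u \<noteq> 0"
        and inf: "\<forall>u\<in>ball c d. \<alpha> u \<noteq> 0 \<and> \<beta> u \<noteq> 0 \<longrightarrow> filterlim (\<lambda>t. F t u) at_infinity (at 0)"
      have op: "open {u\<in>V. f u \<noteq> 0}" if "open V" "V \<subseteq> ball c d" "f holomorphic_on ball c d" for f V
        using continuous_open_preimage[of V f "-{0}"] holomorphic_on_imp_continuous_on[OF that(3)] that
        by (auto simp: vimage_def Int_def intro: continuous_on_subset)
      \<comment> \<open>\<open>A\<close> is shrunk to a nonempty open set on which neither
        \<open>\<alpha>\<close> nor \<open>\<beta>\<close> vanishes. It still meets
        \<open>W\<close>, and there the limit would be both finite and infinite.\<close>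
      define V where "V = ball c d \<inter> A"
      have V: "open V" "V \<subseteq> ball c d" by (auto simp: V_def A_def)
      have Vne: "V \<noteq> {}" using u0 *(1) unfolding V_def
        by (metis Int_commute closure_iff_nhds_not_empty open_ball subset_refl)
      obtain u1 where u1: "u1 \<in> V" "\<alpha> u1 \<noteq> 0"
        using nonzero_holomorphic_dense[OF *(2) _ _ V(1) Vne V(2)] *(4) by metis
      define V1 where "V1 = {u\<in>V. \<alpha> u \<noteq> 0}"
      have V1: "open V1" "V1 \<subseteq> ball c d" "V1 \<noteq> {}"
        using op[OF V *(2)] V u1 by (auto simp: V1_def)
      obtain u2 where u2: "u2 \<in> V1" "\<beta> u2 \<noteq> 0"
        using nonzero_holomorphic_dense[OF *(3) _ _ V1(1,3,2)] \<beta> by metis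
      define V2 where "V2 = {u\<in>V1. \<beta> u \<noteq> 0}"
      have V2: "open V2" "u2 \<in> V2" "V2 \<subseteq> A" "\<And>u. u \<in> V2 \<Longrightarrow> u \<in> ball c d \<and> \<alpha> u \<noteq> 0 \<and> \<beta> u \<noteq> 0"
        using op[OF V1(1,2) *(3)] u2 by (auto simp: V2_def V1_def V_def)
      have "u2 \<in> closure W" using V2 interior_subset by (auto simp: A_def)
      then obtain u where u: "u \<in> V2" "u \<in> W"
        using V2(1,2) by (metis closure_iff_nhds_not_empty disjoint_iff subset_refl)
      then obtain L where "(\<lambda>t. F t u) \<midarrow>0\<rightarrow> L" by (auto simp: W_def)
      moreover have "filterlim (\<lambda>t. F t u) at_infinity (at 0)" using inf V2(4)[OF u(1)] by auto
      ultimately show False using not_tendsto_and_filterlim_at_infinity[of "at (0::complex)"] by auto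
    qed
    thus ?thesis using * by blast
  qed
  have "closure A \<subseteq> A"
  proof
    fix u0 assume "u0 \<in> closure A"
    then obtain c d \<alpha> \<beta> where *: "u0 \<in> ball c d" "\<alpha> holomorphic_on ball c d" "\<exists>u\<in>ball c d. \<alpha> u \<noteq> 0"
       "\<forall>u\<in>ball c d. \<alpha> u \<noteq> 0 \<longrightarrow> (\<lambda>t. F t u) \<midarrow>0\<rightarrow> \<beta> u / \<alpha> u" using key by metis
    have "ball c d \<subseteq> closure W"
    proof
      fix u assume u: "u \<in> ball c d"
      show "u \<in> closure W"
        unfolding closure_iff_nhds_not_empty
      proof (intro allI impI)
        fix B V assume BV: "V \<subseteq> B" "open V" "u \<in> V"
        have ne: "V \<inter> ball c d \<noteq> {}" using BV u by auto
        obtain w where "w \<in> V \<inter> ball c d" "\<alpha> w \<noteq> 0"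
          using nonzero_holomorphic_dense[OF *(2) _ _ _ ne] *(3) BV(2) by (metis inf_le2 open_Int open_ball)
        moreover from this have "w \<in> W" using *(4) unfolding W_def by blast
        ultimately show "W \<inter> B \<noteq> {}" using BV(1) by blast
      qed
    qed
    thus "u0 \<in> A" unfolding A_def using *(1) by (meson interior_maximal open_ball subsetD)
  qed
  hence "closed A" using closure_subset_eq by blast
  moreover have "open A" by (simp add: A_def)
  moreover have "U \<subseteq> A" unfolding A_def
    using U closure_subset[of W] by (intro interior_maximal) (auto simp: W_def)
  ultimately have AU: "A = UNIV" using clopen[of A] U(2) by auto
  show ?thesis unfolding meromorphic_on_meromorphic_at[of _ UNIV]
  proof
    fix u0 :: complex
    obtain c d \<alpha> \<beta> where *: "u0 \<in> ball c d" "\<alpha> holomorphic_on ball c d" "\<beta> holomorphic_on ball c d" "\<exists>u\<in>ball c d. \<alpha> u \<noteq> 0"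
       "\<forall>u\<in>ball c d. \<alpha> u \<noteq> 0 \<longrightarrow> (\<lambda>t. F t u) \<midarrow>0\<rightarrow> \<beta> u / \<alpha> u"
      using key[of u0] AU by (metis UNIV_I closure_UNIV)
    have "\<alpha> analytic_on {u0}" "\<beta> analytic_on {u0}" using *(1-3) by (auto simp: analytic_at intro!: exI[of _ "ball c d"])
    hence m: "(\<lambda>u. \<beta> u / \<alpha> u) meromorphic_on {u0}" by (intro meromorphic_intros analytic_on_imp_meromorphic_on)
    \<comment> \<open>The zeros of \<open>\<alpha>\<close> are isolated, so
      \<open>\<beta> / \<alpha>\<close> and the limit agree on a punctured neighbourhood, which is
      all that meromorphy sees.\<close>
    have ev: "eventually (\<lambda>u. \<alpha> u \<noteq> 0) (at u0)"
    proof (cases "\<alpha> u0 = 0")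
      case True
      obtain u1 where u1: "u1 \<in> ball c d" "\<alpha> u1 \<noteq> 0" using * by blast
      obtain r where "0 < r" "\<And>z. z \<in> ball u0 r - {u0} \<Longrightarrow> \<alpha> z \<noteq> 0"
        by (rule isolated_zeros[OF *(2) _ _ _ True u1]) (use * in auto)
      thus ?thesis using eventually_at_in_open[of "ball u0 r" u0] by (auto elim: eventually_mono)
    next
      case False
      have "isCont \<alpha> u0" using holomorphic_on_imp_continuous_on[OF *(2)] * by (simp add: continuous_on_eq_continuous_at)
      thus ?thesis using False by (simp add: isCont_def tendsto_imp_eventually_ne)
    qed
    moreover have "eventually (\<lambda>u. u \<in> ball c d - {u0}) (at u0)" by (rule eventually_at_in_open) (use * in auto)
    ultimately have "eventually (\<lambda>u. \<beta> u / \<alpha> u = Lim (at 0) (\<lambda>t. F t u)) (at u0)"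
      by eventually_elim (use *(5) in \<open>auto intro!: tendsto_Lim[symmetric]\<close>)
    hence "(\<lambda>u. \<beta> u / \<alpha> u) meromorphic_on {u0} \<longleftrightarrow> (\<lambda>u. Lim (at 0) (\<lambda>t. F t u)) meromorphic_on {u0}"
      by (intro meromorphic_on_cong) auto
    thus "(\<lambda>u. Lim (at 0) (\<lambda>t. F t u)) meromorphic_on {u0}" using m by simp
  qed
qed

section \<open>Holomorphic functions of several variables along complex lines\<close>

lemma norm_vector_scalar_mult: "norm (c *s (v :: complex ^ 'n)) = norm c * norm v"
  by (simp add: norm_vec_def norm_mult L2_set_right_distrib)

lemma bounded_linear_vector_scalar_mult: "bounded_linear (\<lambda>c. c *s (v :: complex ^ 'n))"
  by (rule bounded_linear_intro[where K = "norm v"])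
     (auto simp: norm_vector_scalar_mult vec_eq_iff algebra_simps)

lemma cvec_holomorphic_on_line:
  assumes "cvec_holomorphic_on f B" and "\<And>c. c \<in> S \<Longrightarrow> x + c *s v \<in> B"
  shows "(\<lambda>c. f (x + c *s v)) holomorphic_on S"
  unfolding holomorphic_on_def field_differentiable_def
proof
  fix c assume c: "c \<in> S"
  obtain D where D: "(f has_derivative D) (at (x + c *s v))" "\<And>c v. D (c *s v) = c * D v"
    using assms c unfolding cvec_holomorphic_on_def by metis
  have "((\<lambda>c. x + c *s v) has_derivative (\<lambda>c. c *s v)) (at c)"
    by (auto intro!: derivative_eq_intros bounded_linear.has_derivative[OF bounded_linear_vector_scalar_mult])
  from has_derivative_compose[OF this D(1)]
  have "((\<lambda>c. f (x + c *s v)) has_derivative (\<lambda>c. D v * c)) (at c)" by (simp add: D(2) mult.commute)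
  hence "((\<lambda>c. f (x + c *s v)) has_field_derivative D v) (at c)"
    by (simp add: has_field_derivative_def mult_commute_abs)
  thus "\<exists>f'. ((\<lambda>c. f (x + c *s v)) has_field_derivative f') (at c within S)"
    using has_field_derivative_at_within by blast
qed

lemma cvec_holomorphic_on_imp_isCont:
  assumes "cvec_holomorphic_on f B" "x \<in> B"
  shows "isCont f x"
  using assms has_derivative_continuous unfolding cvec_holomorphic_on_def by metis

text \<open>Join \<open>y\<close> to \<open>w\<close> by a complex line. It meets the ball in a
  convex, hence connected set of parameters, and the one-variable identity theorem carries the zeros
  near parameter 0 to parameter 1.\<close>

lemma cvec_holomorphic_identity:
  assumes hol: "cvec_holomorphic_on f (ball z r)" and e: "e > 0" "y \<in> ball z r"
    and zero: "\<And>w. w \<in> ball y e \<Longrightarrow> f w = 0" and w: "w \<in> ball z r"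
  shows "f w = 0"
proof -
  define S where "S = {c. y + c *s (w - y) \<in> ball z r}"
  have blin: "bounded_linear (\<lambda>c. c *s (w - y))" by (rule bounded_linear_vector_scalar_mult)
  have S_eq: "S = (\<lambda>c. c *s (w - y)) -` ball (z - y) r"
    by (auto simp: S_def dist_norm algebra_simps)
  have S: "open S" "convex S" unfolding S_eq
    using bounded_linear.linear[OF blin] linear_continuous_at[OF blin]
    by (auto intro!: open_vimage convex_linear_vimage continuous_at_imp_continuous_on)
  define T where "T = (\<lambda>c. c *s (w - y)) -` ball 0 e \<inter> S"
  have T: "open T" unfolding T_def
    using linear_continuous_at[OF blin] S
    by (intro open_Int open_vimage) (auto intro!: continuous_at_imp_continuous_on)
  have "0 \<in> T" using e by (auto simp: T_def S_def)
  have "T \<noteq> {}" using \<open>0 \<in> T\<close> by blast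
  have "T \<subseteq> S" by (simp add: T_def)
  have T0: "f (y + c *s (w - y)) = 0" if "c \<in> T" for c
    using that by (intro zero) (auto simp: T_def dist_norm)
  have "(\<lambda>c. f (y + c *s (w - y))) holomorphic_on S"
    by (rule cvec_holomorphic_on_line[OF hol]) (auto simp: S_def)
  hence "f (y + 1 *s (w - y)) = 0"
    by (intro analytic_continuation_open[of T S "\<lambda>c. f (y + c *s (w - y))" "\<lambda>_. 0" 1])
       (use S T \<open>T \<noteq> {}\<close> \<open>T \<subseteq> S\<close> convex_connected[OF S(2)] w T0 in \<open>auto simp: S_def\<close>)
  thus ?thesis by simp
qed

text \<open>For a single \<open>k\<close>, the directions along which \<open>h k\<close> is nonzero
  somewhere within reach form a dense open set, so Baire's theorem yields one direction that is good
  for all \<open>k\<close>.\<close>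

lemma generic_direction:
  fixes z :: "nat \<Rightarrow> complex ^ 'n" and h :: "nat \<Rightarrow> complex ^ 'n \<Rightarrow> complex"
  assumes hol: "\<And>k. cvec_holomorphic_on (h k) (ball (z k) (r k))"
    and nz: "\<And>k. \<exists>w\<in>ball (z k) (r k). h k w \<noteq> 0" and d: "\<And>k. 0 < d k" "\<And>k. d k \<le> r k"
  obtains v where "norm v \<le> 1" "\<And>k. \<exists>t. norm t < d k \<and> h k (z k + t *s v) \<noteq> 0"
proof -
  \<comment> \<open>The weight \<open>norm v + 1\<close> anticipates the normalisation at the end:
    once \<open>v\<close> is divided by it and \<open>t\<close> multiplied by it, the condition
    reads \<open>norm t < d k\<close>.\<close>
  define G where "G k = {v. \<exists>t. norm t * (norm v + 1) < d k \<and> h k (z k + t *s v) \<noteq> 0}" for k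
  have inball: "z k + t *s v \<in> ball (z k) (r k)" if "norm t * (norm v + 1) < d k" for k t v
  proof -
    have "norm t * norm v \<le> norm t * (norm v + 1)" by (intro mult_left_mono) auto
    thus ?thesis using that d(2)[of k] by (auto simp: dist_norm norm_vector_scalar_mult)
  qed
  have op: "open (G k)" for k
  proof -
    have "G k = (\<Union>t. {v. norm t * (norm v + 1) < d k \<and> h k (z k + t *s v) \<noteq> 0})"
      by (auto simp: G_def)
    moreover have "open ({v. norm t * (norm v + 1) < d k \<and> h k (z k + t *s v) \<noteq> 0})" for t
    proof -
      let ?V = "{v. norm t * (norm v + 1) < d k}"
      have V: "open ?V" by (intro open_Collect_less continuous_intros)
      have c: "continuous (at v) (\<lambda>v. z k + t *s v)" for v
        by (intro continuous_intros linear_continuous_at bounded_linear_intro[where K = "norm t"])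
           (auto simp: norm_vector_scalar_mult vec_eq_iff algebra_simps)
      have "continuous_on ?V (\<lambda>v. h k (z k + t *s v))"
        by (intro continuous_at_imp_continuous_on ballI isCont_o2[OF c]
              cvec_holomorphic_on_imp_isCont[OF hol]) (use inball in auto)
      hence "open (?V \<inter> (\<lambda>v. h k (z k + t *s v)) -` (-{0}))"
        using V by (intro continuous_open_preimage) auto
      moreover have "?V \<inter> (\<lambda>v. h k (z k + t *s v)) -` (-{0}) = {v. norm t * (norm v + 1) < d k \<and> h k (z k + t *s v) \<noteq> 0}"
        by auto
      ultimately show ?thesis by simp
    qed
    ultimately show ?thesis by (simp only: open_UN ball_simps simp_thms)
  qed
  have dense: "v0 \<in> closure (G k)" for v0 k
  proof (rule ccontr)
    assume "v0 \<notin> closure (G k)"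
    then obtain e where e: "e > 0" "ball v0 e \<inter> G k = {}"
      by (metis closure_approachable disjoint_iff dist_commute mem_ball)
    \<comment> \<open>With this \<open>t0\<close> every direction in the ball around
      \<open>v0\<close> is admissible, so the points \<open>z k + t0 *s v\<close> fill a ball of
      radius \<open>t0 * e\<close>. A whole ball of zeros makes \<open>h k\<close> vanish
      throughout.\<close>
    define t0 where "t0 = d k / (norm v0 + e + 1)"
    have n: "norm v0 + e + 1 > 0" using e by (auto intro: add_pos_pos add_nonneg_pos)
    have t0: "t0 > 0" using d n by (auto simp: t0_def)
    have bd: "norm (complex_of_real t0) * (norm v + 1) < d k" if "v \<in> ball v0 e" for v
    proof -
      have "norm v < norm v0 + e" using that norm_triangle_ineq[of v0 "v - v0"] by (auto simp: dist_norm norm_minus_commute)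
      hence "d k * (norm v + 1) < d k * (norm v0 + e + 1)" using d by (intro mult_strict_left_mono) auto
      hence "t0 * (norm v + 1) < d k" using n by (simp add: t0_def divide_less_eq pos_divide_less_eq)
      thus ?thesis using t0 by simp
    qed
    have zero: "h k (z k + complex_of_real t0 *s v) = 0" if "v \<in> ball v0 e" for v
    proof -
      have "v \<notin> G k" using e(2) that by blast
      thus ?thesis using bd[OF that] unfolding G_def by blast
    qed
    obtain w where w: "w \<in> ball (z k) (r k)" "h k w \<noteq> 0" using nz by blast
    have "h k w = 0"
    proof (rule cvec_holomorphic_identity[OF hol _ _ _ w(1)])
      show "t0 * e > 0" using t0 e by simp
      show "z k + complex_of_real t0 *s v0 \<in> ball (z k) (r k)"
        using bd[of v0] e inball by auto
      fix x assume x: "x \<in> ball (z k + complex_of_real t0 *s v0) (t0 * e)"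
      define v where "v = (1 / complex_of_real t0) *s (x - z k)"
      have xv: "x = z k + complex_of_real t0 *s v" using t0 by (auto simp: v_def vec_eq_iff)
      have "x - (z k + complex_of_real t0 *s v0) = complex_of_real t0 *s (v - v0)"
        by (auto simp: xv vec_eq_iff algebra_simps)
      hence "norm (x - (z k + complex_of_real t0 *s v0)) = t0 * norm (v - v0)"
        by (simp only: norm_vector_scalar_mult norm_of_real abs_of_pos[OF t0])
      hence "v \<in> ball v0 e" using x t0 by (auto simp: dist_norm norm_minus_commute)
      thus "h k x = 0" using zero xv by simp
    qed
    thus False using w by simp
  qed
  have "UNIV \<subseteq> closure (\<Inter>(range G))"
    by (rule Baire) (use op dense in auto)
  hence "\<Inter>(range G) \<noteq> {}" by auto
  then obtain v where v: "v \<in> G k" for k by blast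
  define v' where "v' = complex_of_real (1 / (norm v + 1)) *s v"
  have n: "norm v + 1 > 0" by (auto intro: add_nonneg_pos)
  hence nv: "norm (complex_of_real (1 + norm v)) = norm v + 1"
    by (simp only: norm_of_real)
  show thesis
  proof (rule that[of v'])
    show "norm v' \<le> 1" using n unfolding v'_def norm_vector_scalar_mult norm_of_real
      by (simp add: field_simps)
    fix k
    obtain t where t: "norm t * (norm v + 1) < d k" "h k (z k + t *s v) \<noteq> 0"
      using v[of k] by (auto simp: G_def)
    have "(t * of_real (norm v + 1)) *s v' = t *s v"
    proof -
      have "(norm v + 1) * (1 / (norm v + 1)) = 1" using n by simp
      hence "complex_of_real (norm v + 1) * complex_of_real (1 / (norm v + 1)) = 1"
        by (metis of_real_mult of_real_1)
      thus ?thesis by (simp only: v'_def vector_smult_assoc mult.assoc mult_1_right)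
    qed
    moreover have "norm (t * of_real (norm v + 1)) < d k"
      using t(1) n by (simp only: norm_mult norm_of_real abs_of_pos)
    ultimately show "\<exists>t. norm t < d k \<and> h k (z k + t *s v') \<noteq> 0"
      using t(2) by metis
  qed
qed

text \<open>Continuity of \<open>F\<close> enters twice: on \<open>U\<close> it makes the
  transversal limit finite, which rules out a generic blow-up along the entire line, and at single
  points it identifies the limit with the value of \<open>F\<close>.\<close>

lemma cvec_meromorphic_restrict_line:
  fixes F :: "complex ^ 'n \<Rightarrow> complex"
  assumes mero: "cvec_meromorphic F"
    and U: "open U" "U \<noteq> {}" "\<And>u. u \<in> U \<Longrightarrow> isCont F (z + u *s e)"
  obtains f where "f meromorphic_on UNIV" "\<And>u. isCont F (z + u *s e) \<Longrightarrow> f u = F (z + u *s e)"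
proof -
  define P where "P z r g h \<longleftrightarrow> r > 0 \<and> cvec_holomorphic_on g (ball z r) \<and> cvec_holomorphic_on h (ball z r) \<and>
        (\<exists>w\<in>ball z r. h w \<noteq> 0) \<and> (\<forall>w\<in>ball z r. h w \<noteq> 0 \<longrightarrow> F w = g w / h w)" for z r g h
  have "\<forall>z. \<exists>r g h. P z r g h" using mero unfolding cvec_meromorphic_def P_def by blast
  then obtain r g h where "\<And>z. P z (r z) (g z) (h z)" by metis
  hence rgh: "\<And>x. r x > 0"
    "\<And>x. cvec_holomorphic_on (g x) (ball x (r x))"  "\<And>x. cvec_holomorphic_on (h x) (ball x (r x))"
    "\<And>x. \<exists>w\<in>ball x (r x). h x w \<noteq> 0"
    "\<And>x w. w \<in> ball x (r x) \<Longrightarrow> h x w \<noteq> 0 \<Longrightarrow> F w = g x w / h x w"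
    by (auto simp: P_def)
  define Z where "Z u = z + u *s e" for u
  \<comment> \<open>A step of less than \<open>d u\<close> along \<open>e\<close> and one of less
    than \<open>d u\<close> along \<open>v\<close>, where \<open>norm v \<le> 1\<close>, together
    stay within \<open>d u * (norm e + 1) = r (Z u)\<close>.\<close>
  define d where "d u = r (Z u) / (norm e + 1)" for u
  have N: "norm e + 1 > 0" by (auto intro: add_nonneg_pos)
  have d: "d u > 0" "d u \<le> r (Z u)" "d u * (norm e + 1) = r (Z u)" for u
    using rgh(1)[of "Z u"] N by (auto simp: d_def field_simps)
  \<comment> \<open>Baire's theorem treats only countably many denominators at once, so the line is
    covered by countably many discs before \<open>v\<close> is chosen.\<close>
  obtain \<F> where \<F>: "\<F> \<subseteq> range (\<lambda>u. ball u (d u))" "countable \<F>" "\<Union>\<F> = (\<Union>u. ball u (d u))"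
    by (rule Lindelof[of "range (\<lambda>u. ball u (d u))"]) auto
  obtain C where C: "countable C" "\<F> = (\<lambda>u. ball u (d u)) ` C"
    using \<F>(1,2) countable_subset_image[of \<F> "\<lambda>u. ball u (d u)" UNIV] by blast
  have cov: "\<exists>u\<in>C. w \<in> ball u (d u)" for w
  proof -
    have "w \<in> (\<Union>u. ball u (d u))" using d(1)[of w] by (intro UN_I[of w]) simp_all
    hence "w \<in> \<Union>\<F>" using \<F>(3) by simp
    thus ?thesis unfolding C(2) by blast
  qed
  have "C \<noteq> {}" using cov by blast
  then obtain uk :: "nat \<Rightarrow> complex" where uk: "range uk = C" using range_from_nat_into[OF _ C(1)] by blast
  obtain v where v: "norm v \<le> 1" "\<And>k. \<exists>t. norm t < d (uk k) \<and> h (Z (uk k)) (Z (uk k) + t *s v) \<noteq> 0"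
    using generic_direction[of "\<lambda>k. h (Z (uk k))" "\<lambda>k. Z (uk k)" "\<lambda>k. r (Z (uk k))" "\<lambda>k. d (uk k)", OF rgh(3) rgh(4) d(1,2)] by blast
  define \<Phi> where "\<Phi> t u = F (Z u + t *s v)" for t u
  have inball: "Z u + t *s v \<in> ball (Z c) (r (Z c))" if "t \<in> ball 0 (d c)" "u \<in> ball c (d c)" for t u c
  proof -
    have "Z u + t *s v - Z c = (u - c) *s e + t *s v" by (simp add: Z_def vec_eq_iff algebra_simps)
    hence "norm (Z u + t *s v - Z c) \<le> norm (u - c) * norm e + norm t * norm v"
      by (metis norm_triangle_ineq norm_vector_scalar_mult)
    also have "\<dots> \<le> d c * norm e + norm t * 1"
      using that v(1) d(1)[of c] by (intro add_mono mult_mono) (auto simp: dist_norm norm_minus_commute)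
    also have "\<dots> < d c * norm e + d c" using that by simp
    also have "\<dots> = r (Z c)" using d(3)[of c] by (simp add: algebra_simps)
    finally show ?thesis by (simp add: dist_norm norm_minus_commute)
  qed
  have slice: "continuous_on (ball 0 (d c) \<times> ball c (d c)) (\<lambda>(t, u). f (Z u + t *s v))"
      "\<And>u. u \<in> ball c (d c) \<Longrightarrow> (\<lambda>t. f (Z u + t *s v)) holomorphic_on ball 0 (d c)"
      "\<And>t. t \<in> ball 0 (d c) \<Longrightarrow> (\<lambda>u. f (Z u + t *s v)) holomorphic_on ball c (d c)"
    if f: "cvec_holomorphic_on f (ball (Z c) (r (Z c)))" for f c
  proof -
    have "continuous_on (ball (Z c) (r (Z c))) f"
      using cvec_holomorphic_on_imp_isCont[OF f] by (auto intro: continuous_at_imp_continuous_on)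
    moreover have "continuous_on S (\<lambda>x. Z (snd x) + fst x *s v)" for S :: "(complex \<times> complex) set"
      unfolding Z_def
      by (intro continuous_intros continuous_on_compose2[OF linear_continuous_on[OF bounded_linear_vector_scalar_mult]]) auto
    ultimately have "continuous_on (ball 0 (d c) \<times> ball c (d c)) (\<lambda>x. f (Z (snd x) + fst x *s v))"
      by (rule continuous_on_compose2) (use inball in auto)
    thus "continuous_on (ball 0 (d c) \<times> ball c (d c)) (\<lambda>(t, u). f (Z u + t *s v))"
      by (simp add: case_prod_unfold)
    show "(\<lambda>t. f (Z u + t *s v)) holomorphic_on ball 0 (d c)" if "u \<in> ball c (d c)" for u
      by (rule cvec_holomorphic_on_line[OF f]) (use inball that in auto)
    have eq: "Z u + t *s v = (z + t *s v) + u *s e" for u t by (simp add: Z_def)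
    show "(\<lambda>u. f (Z u + t *s v)) holomorphic_on ball c (d c)" if "t \<in> ball 0 (d c)" for t
      unfolding eq by (rule cvec_holomorphic_on_line[OF f]) (use inball that eq in auto)
  qed
  have tend: "(\<lambda>t. \<Phi> t u) \<midarrow>0\<rightarrow> F (Z u)" if "isCont F (Z u)" for u
  proof -
    have "isCont (\<lambda>t. Z u + t *s v) 0"
      by (intro continuous_intros linear_continuous_at bounded_linear_vector_scalar_mult)
    hence "isCont (\<lambda>t. F (Z u + t *s v)) 0" by (rule isCont_o2) (use that in simp)
    thus ?thesis by (simp add: isCont_def \<Phi>_def)
  qed
  show thesis
  proof (rule that)
    show "(\<lambda>u. Lim (at 0) (\<lambda>t. \<Phi> t u)) meromorphic_on UNIV"
    proof (rule iterated_limit_meromorphic[OF _ U(1,2)])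
      show "\<exists>L. (\<lambda>t. \<Phi> t u) \<midarrow>0\<rightarrow> L" if "u \<in> U" for u
        using tend U(3)[OF that] Z_def by metis
      fix u0
      obtain k where k: "u0 \<in> ball (uk k) (d (uk k))" using cov[of u0] unfolding uk[symmetric] by auto
      let ?c = "uk k"
      obtain t1 where t1: "norm t1 < d ?c" "h (Z ?c) (Z ?c + t1 *s v) \<noteq> 0" using v(2) by blast
      have Feq: "\<Phi> t u = g (Z ?c) (Z u + t *s v) / h (Z ?c) (Z u + t *s v)"
        if "t \<in> ball 0 (d ?c)" "u \<in> ball ?c (d ?c)" "h (Z ?c) (Z u + t *s v) \<noteq> 0" for t u
        unfolding \<Phi>_def using inball[OF that(1,2)] that(3) by (rule rgh(5))
      have t1b: "t1 \<in> ball 0 (d ?c)" and cb: "?c \<in> ball ?c (d ?c)" using t1 d(1) by simp_all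
      note g_slice = slice[OF rgh(2)[of "Z ?c"]] and h_slice = slice[OF rgh(3)[of "Z ?c"]]
      obtain \<alpha> \<beta> where ab: "\<alpha> holomorphic_on ball ?c (d ?c)" "\<beta> holomorphic_on ball ?c (d ?c)"
        "\<exists>u\<in>ball ?c (d ?c). \<alpha> u \<noteq> 0"
        "(\<forall>u\<in>ball ?c (d ?c). \<alpha> u \<noteq> 0 \<longrightarrow> (\<lambda>t. \<Phi> t u) \<midarrow>0\<rightarrow> \<beta> u / \<alpha> u) \<or>
         (\<exists>u\<in>ball ?c (d ?c). \<beta> u \<noteq> 0) \<and>
         (\<forall>u\<in>ball ?c (d ?c). \<alpha> u \<noteq> 0 \<and> \<beta> u \<noteq> 0 \<longrightarrow> filterlim (\<lambda>t. \<Phi> t u) at_infinity (at 0))"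
      proof -
        show thesis
        by (rule quotient_limit[where g = "\<lambda>t u. g (Z ?c) (Z u + t *s v)" and
              h = "\<lambda>t u. h (Z ?c) (Z u + t *s v)" and d = "d ?c" and ?u0.0 = ?c and F = \<Phi>])
           (assumption | rule g_slice h_slice Feq t1b cb t1(2) that)+
      qed
      show "\<exists>c d \<alpha> \<beta>. u0 \<in> ball c d \<and> \<alpha> holomorphic_on ball c d \<and> \<beta> holomorphic_on ball c d \<and>
         (\<exists>u\<in>ball c d. \<alpha> u \<noteq> 0) \<and>
         ((\<forall>u\<in>ball c d. \<alpha> u \<noteq> 0 \<longrightarrow> (\<lambda>t. \<Phi> t u) \<midarrow>0\<rightarrow> \<beta> u / \<alpha> u) \<or>
          (\<exists>u\<in>ball c d. \<beta> u \<noteq> 0) \<and>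
          (\<forall>u\<in>ball c d. \<alpha> u \<noteq> 0 \<and> \<beta> u \<noteq> 0 \<longrightarrow> filterlim (\<lambda>t. \<Phi> t u) at_infinity (at 0)))"
        by (intro exI conjI, rule k) (fact ab)+
    qed
    show "Lim (at 0) (\<lambda>t. \<Phi> t u) = F (z + u *s e)" if "isCont F (z + u *s e)" for u
      using tendsto_Lim[OF _ tend[of u]] that by (simp add: Z_def)
  qed
qed

section \<open>Sums of rational functions over the integers\<close>

text \<open>
  The coefficients of the partial fraction decomposition of \<open>1 / (x ^ p * y ^ c)\<close> with \<open>y = x + D\<close>,
  extended to \<open>r = 0\<close>. With the binomial coefficients in this form, the recurrence
  \<open>D w(p, c) = w(p, c - 1) - w(p - 1, c)\<close> persists down to \<open>p = 0\<close> and \<open>c = 0\<close>, where truncated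
  subtraction gives \<open>0 - 1 choose 0 = 1\<close>.
\<close>

definition pole_coeff :: "'a::field \<Rightarrow> nat \<Rightarrow> nat \<Rightarrow> nat \<Rightarrow> 'a" where
  "pole_coeff D p c r = (if r \<le> p then (-1) ^ p * of_nat ((p + c - 1 - r) choose (p - r)) / D ^ (p + c - r) else 0)"

definition pole_coeff' :: "'a::field \<Rightarrow> nat \<Rightarrow> nat \<Rightarrow> nat \<Rightarrow> 'a" where
  "pole_coeff' D p c r = (if r \<le> c then (-1) ^ p * of_nat ((p + c - 1 - r) choose (c - r)) / D ^ (p + c - r) else 0)"

text \<open>Pascal's rule for \<open>r \<le> p\<close>. At \<open>r = Suc p\<close> the subtracted
  coefficient is 0 by definition and only powers of \<open>D\<close> are compared.\<close>

lemma pole_coeff_rec: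
  assumes "D \<noteq> 0"
  shows "pole_coeff D (Suc p) (Suc c) r = (pole_coeff D (Suc p) c r - pole_coeff D p (Suc c) r) / D"
proof -
  consider "r \<le> p" | "r = Suc p" | "r > Suc p" by linarith
  thus ?thesis
  proof cases
    case 1
    then obtain d where d: "p = r + d" using le_Suc_ex by blast
    show ?thesis using assms by (simp add: pole_coeff_def d field_simps)
  qed (use assms in \<open>auto simp: pole_coeff_def\<close>)
qed

lemma pole_coeff'_rec:
  assumes "D \<noteq> 0"
  shows "pole_coeff' D (Suc p) (Suc c) r = (pole_coeff' D (Suc p) c r - pole_coeff' D p (Suc c) r) / D"
proof -
  consider "r \<le> c" | "r = Suc c" | "r > Suc c" by linarith
  thus ?thesis
  proof cases
    case 1
    then obtain d where d: "c = r + d" using le_Suc_ex by blast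
    have "p + (r + d) - r = p + d" by simp
    thus ?thesis using assms by (simp add: pole_coeff'_def d field_simps)
  qed (use assms in \<open>auto simp: pole_coeff'_def\<close>)
qed

lemma pole_coeff_0_right: "pole_coeff D p 0 r = (if r = p then (-1) ^ p else 0)"
proof -
  consider "r < p" | "r = p" | "r > p" by linarith
  thus ?thesis by cases (auto simp: pole_coeff_def binomial_eq_0)
qed

lemma pole_coeff'_0_left: "pole_coeff' D 0 c r = (if r = c then 1 else 0)"
proof -
  consider "r < c" | "r = c" | "r > c" by linarith
  thus ?thesis by cases (auto simp: pole_coeff'_def binomial_eq_0)
qed

text \<open>The value that partial fractions assign to the sum of
  \<open>g / (x ^ p * y ^ c)\<close>. For \<open>r > 0\<close>, \<open>e r\<close> stands for the
  sum of \<open>g / (- x) ^ r\<close>, which is why \<open>pole_coeff\<close> has the sign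
  \<open>(-1) ^ p\<close> and not \<open>(-1) ^ (p - r)\<close>, and \<open>e' r\<close> for the sum
  of \<open>g / y ^ r\<close>. The entries at 0 are minus the values of \<open>g\<close> at the two
  poles.\<close>

definition pole_sum :: "'a::field \<Rightarrow> (nat \<Rightarrow> 'a) \<Rightarrow> (nat \<Rightarrow> 'a) \<Rightarrow> nat \<Rightarrow> nat \<Rightarrow> 'a" where
  "pole_sum D e e' p c = (\<Sum>r\<le>p. pole_coeff D p c r * e r) + (\<Sum>r\<le>c. pole_coeff' D p c r * e' r)"

lemma pole_sum_rec:
  assumes "D \<noteq> 0"
  shows "pole_sum D e e' (Suc p) (Suc c) = (pole_sum D e e' (Suc p) c - pole_sum D e e' p (Suc c)) / D"
proof -
  have "pole_sum D e e' (Suc p) c =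
      (\<Sum>r\<le>Suc p. pole_coeff D (Suc p) c r * e r) + (\<Sum>r\<le>Suc c. pole_coeff' D (Suc p) c r * e' r)"
    "pole_sum D e e' p (Suc c) =
      (\<Sum>r\<le>Suc p. pole_coeff D p (Suc c) r * e r) + (\<Sum>r\<le>Suc c. pole_coeff' D p (Suc c) r * e' r)"
    by (simp_all add: pole_sum_def pole_coeff_def pole_coeff'_def)
  thus ?thesis
    by (simp only: pole_sum_def[of D e e' "Suc p" "Suc c"] pole_coeff_rec[OF assms] pole_coeff'_rec[OF assms]
      times_divide_eq_left diff_divide_distrib add_divide_distrib sum_divide_distrib sum_subtractf left_diff_distrib add_diff_add)
qed

lemma pole_sum_0_right: "p > 0 \<Longrightarrow> pole_sum D e e' p 0 = (-1) ^ p * e p + (-1) ^ p / D ^ p * e' 0"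
  by (simp add: pole_sum_def pole_coeff_0_right pole_coeff'_def if_distrib[of "\<lambda>x. x * _"] sum.delta cong: if_cong)

lemma pole_sum_0_left: "c > 0 \<Longrightarrow> pole_sum D e e' 0 c = e' c + e 0 / D ^ c"
  by (simp add: pole_sum_def pole_coeff'_0_left pole_coeff_def if_distrib[of "\<lambda>x. x * _"] sum.delta cong: if_cong)

lemma has_sum_diff:
  fixes f g :: "'i \<Rightarrow> complex"
  assumes "(f has_sum a) A" "(g has_sum b) A"
  shows "((\<lambda>x. f x - g x) has_sum (a - b)) A"
  using has_sum_add[OF assms(1), of "\<lambda>x. - g x" "- b"] assms(2) by (simp add: has_sum_uminus)

lemma has_sum_transform:
  "(f has_sum s) A \<Longrightarrow> s = s' \<Longrightarrow> (\<And>x. x \<in> A \<Longrightarrow> f x = g x) \<Longrightarrow> (g has_sum s') A"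
  using has_sum_cong[of A f g s] by simp

text \<open>From \<open>y - x = D\<close> the summands satisfy the recurrence of
  \<open>pole_sum\<close>, so induction on \<open>p + c\<close> reduces everything to vanishing
  \<open>p\<close> or \<open>c\<close>. From \<open>(1, 1)\<close> this would lead to total exponent
  1, where convergence may fail; hence that case is a separate hypothesis.\<close>

lemma has_sum_two_poles:
  fixes x y g :: "'i \<Rightarrow> complex"
  assumes D: "D \<noteq> 0" "\<And>i. i \<in> A \<Longrightarrow> y i = x i + D" and nz: "\<And>i. i \<in> A \<Longrightarrow> x i \<noteq> 0" "\<And>i. i \<in> A \<Longrightarrow> y i \<noteq> 0"
    and p: "\<And>p. p \<ge> 2 \<Longrightarrow> ((\<lambda>i. g i / x i ^ p) has_sum ((-1) ^ p * e p + (-1) ^ p / D ^ p * e' 0)) A"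
    and c: "\<And>c. c \<ge> 2 \<Longrightarrow> ((\<lambda>i. g i / y i ^ c) has_sum (e' c + e 0 / D ^ c)) A"
    and pc: "((\<lambda>i. g i / (x i * y i)) has_sum pole_sum D e e' 1 1) A"
    and "p + c \<ge> 2"
  shows "((\<lambda>i. g i / (x i ^ p * y i ^ c)) has_sum pole_sum D e e' p c) A"
  using \<open>p + c \<ge> 2\<close>
proof (induction "p + c" arbitrary: p c rule: less_induct)
  case less
  consider "c = 0" | "p = 0" | "p = 1" "c = 1" | p' c' where "p = Suc p'" "c = Suc c'" "p + c > 2"
    using less.prems by (cases p; cases c) fastforce+
  thus ?case
  proof cases
    case 1
    thus ?thesis using p[of p] less.prems by (simp add: pole_sum_0_right)
  next
    case 2
    thus ?thesis using c[of c] less.prems by (simp add: pole_sum_0_left)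
  next
    case 3
    thus ?thesis using pc by simp
  next
    case 4
    have "((\<lambda>i. g i / (x i ^ Suc p' * y i ^ c')) has_sum pole_sum D e e' (Suc p') c') A"
         "((\<lambda>i. g i / (x i ^ p' * y i ^ Suc c')) has_sum pole_sum D e e' p' (Suc c')) A"
      by (rule less.hyps; use 4 in linarith)+
    hence "((\<lambda>i. (g i / (x i ^ Suc p' * y i ^ c') - g i / (x i ^ p' * y i ^ Suc c')) / D) has_sum pole_sum D e e' p c) A"
      unfolding 4 pole_sum_rec[OF D(1)] divide_inverse[of _ D] by (intro has_sum_cmult_left has_sum_diff)
    also have "?this \<longleftrightarrow> ?thesis"
    proof (rule has_sum_cong)
      fix i assume i: "i \<in> A"
      have "x i \<noteq> 0" "x i + D \<noteq> 0" using nz D i by metis+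
      thus "(g i / (x i ^ Suc p' * y i ^ c') - g i / (x i ^ p' * y i ^ Suc c')) / D = g i / (x i ^ p * y i ^ c)"
        using D(1) unfolding D(2)[OF i] 4 by (simp add: divide_simps) (simp add: algebra_simps)
    qed
    finally show ?thesis .
  qed
qed

text \<open>
  The sum of \<open>1 / l ^ k\<close> over \<open>l \<noteq> 0\<close>, where \<open>0\<close> is the symmetric value for \<open>k = 1\<close>. The value
  \<open>-1\<close> at \<open>k = 0\<close> accounts for the integers that are left out because they are poles.
\<close>

definition zeta_int :: "nat \<Rightarrow> complex" where
  "zeta_int k = (if odd k then 0 else 2 * riemann_zeta (of_nat k))"

lemma zeta_int_0: "zeta_int 0 = -1"
  using riemann_zeta_0 by (simp add: zeta_int_def)

lemma has_sum_int_split: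
  fixes f :: "int \<Rightarrow> complex"
  assumes "((\<lambda>n. f (int (Suc n))) has_sum a) UNIV" "((\<lambda>n. f (- int (Suc n))) has_sum b) UNIV"
  shows "(f has_sum (a + b)) (- {0})"
proof -
  have "(f has_sum a) (range (\<lambda>n. int (Suc n)))"
    using assms(1) by (subst has_sum_reindex) (auto simp: inj_def o_def)
  moreover have "(f has_sum b) (range (\<lambda>n. - int (Suc n)))"
    using assms(2) by (subst has_sum_reindex) (auto simp: inj_def o_def)
  moreover have "range (\<lambda>n. int (Suc n)) \<inter> range (\<lambda>n. - int (Suc n)) = {}" by auto
  moreover have "range (\<lambda>n. int (Suc n)) \<union> range (\<lambda>n. - int (Suc n)) = - {0}"
  proof -
    have "l \<in> range (\<lambda>n. int (Suc n)) \<union> range (\<lambda>n. - int (Suc n))" if "l \<noteq> 0" for l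
    proof (cases "l > 0")
      case True
      hence "l = int (Suc (nat (l - 1)))" by simp
      thus ?thesis by blast
    next
      case False
      hence "l = - int (Suc (nat (- l - 1)))" using that by simp
      thus ?thesis by blast
    qed
    thus ?thesis by auto
  qed
  ultimately show ?thesis using has_sum_Un_disjoint by metis
qed

lemma has_sum_zeta_int:
  assumes "k \<ge> 2"
  shows "((\<lambda>l. 1 / of_int l ^ k) has_sum zeta_int k) (- {0})"
proof -
  have eq: "complex_of_nat (Suc n) powr of_nat k = of_nat (Suc n) ^ k" for n
    by (rule powr_nat') (auto simp del: of_nat_Suc)
  have sum: "summable (\<lambda>n. norm (1 / complex_of_nat (Suc n) ^ k))"
    using inverse_power_summable[OF assms, where 'a = real]
    by (subst summable_Suc_iff[of "\<lambda>n. norm (1 / complex_of_nat n ^ k)"])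
       (auto simp: norm_divide norm_power inverse_eq_divide power_one_over)
  have "(\<lambda>n. 1 / complex_of_nat (Suc n) ^ k) sums riemann_zeta (of_nat k)"
    using summable_norm_cancel[OF sum] assms unfolding riemann_zeta_def
    by (simp add: eq summable_sums del: of_nat_Suc)
  hence z: "((\<lambda>n. 1 / complex_of_nat (Suc n) ^ k) has_sum riemann_zeta (of_nat k)) UNIV"
    using norm_summable_imp_has_sum[OF sum] by blast
  have "((\<lambda>l. 1 / of_int l ^ k) has_sum (riemann_zeta (of_nat k) + (-1) ^ k * riemann_zeta (of_nat k))) (- {0})"
  proof (rule has_sum_int_split)
    show "((\<lambda>n. 1 / complex_of_int (int (Suc n)) ^ k) has_sum riemann_zeta (of_nat k)) UNIV" using z by simp
    have "((\<lambda>n. (-1) ^ k * (1 / complex_of_nat (Suc n) ^ k)) has_sum (-1) ^ k * riemann_zeta (of_nat k)) UNIV"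
      by (intro has_sum_cmult_right z)
    moreover have "(-1) ^ k * (1 / complex_of_nat (Suc n) ^ k) = 1 / complex_of_int (- int (Suc n)) ^ k" for n
      unfolding of_int_minus of_int_of_nat_eq power_minus[of "of_nat (Suc n)"]
      by (simp add: divide_simps flip: power_mult_distrib del: of_nat_Suc)
    ultimately show "((\<lambda>n. 1 / complex_of_int (- int (Suc n)) ^ k) has_sum (-1) ^ k * riemann_zeta (of_nat k)) UNIV"
      by simp
  qed
  thus ?thesis by (cases "odd k") (auto simp: zeta_int_def)
qed

lemma has_sum_int_shift:
  fixes f :: "int \<Rightarrow> complex"
  assumes "(f has_sum s) B" "\<And>l. l \<in> A \<longleftrightarrow> l + m \<in> B"
  shows "((\<lambda>l. f (l + m)) has_sum s) A"
proof -
  have "bij_betw (\<lambda>l. l + m) A B"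
    by (rule bij_betwI[where g = "\<lambda>l. l - m"]) (use assms(2) in \<open>auto simp: assms(2)\<close>)
  from has_sum_reindex_bij_betw[OF this, of f s] show ?thesis using assms(1) by simp
qed

lemma has_sum_remove:
  assumes "(f has_sum s) A" "x \<in> A"
  shows "(f has_sum (s - f x :: complex)) (A - {x})"
  using assms has_sum_finite[of "{x}" f] by (intro has_sum_Diff) auto

text \<open>With \<open>1 / 0 = 0\<close> the positive integers contribute 1, the point
  \<open>l = 0\<close> contributes -1, and the negative integers telescope to 0. This is the
  absolutely convergent substitute for the symmetric summation of \<open>1 / l\<close>.\<close>

lemma has_sum_telescope_step:
  "((\<lambda>l. 1 / complex_of_int l - 1 / of_int (l + 1)) has_sum 0) UNIV"
proof -
  let ?f = "\<lambda>l. 1 / complex_of_int l - 1 / of_int (l + 1)"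
  have lim: "(\<lambda>n. c / complex_of_nat n) \<longlonglongrightarrow> 0" for c
    by (rule lim_const_over_n)
  have sq: "summable (\<lambda>n. 2 * (1 / real (Suc n) ^ 2))"
    using inverse_power_summable[of 2, where 'a = real]
    by (intro summable_mult, subst summable_Suc_iff[of "\<lambda>n. 1 / real n ^ 2"]) (auto simp: inverse_eq_divide)
  have "((\<lambda>n. ?f (int (Suc n))) has_sum 1) UNIV"
  proof (rule norm_summable_imp_has_sum)
    have eq: "norm (?f (int (Suc n))) = 1 / (real (Suc n) * real (Suc n + 1))" for n
    proof -
      have "1 / (real (Suc n) * real (Suc n + 1)) = 1 / real (Suc n) - 1 / real (Suc n + 1)"
        by (simp add: field_simps)
      hence "?f (int (Suc n)) = complex_of_real (1 / (real (Suc n) * real (Suc n + 1)))"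
        by simp
      thus ?thesis by (simp only: norm_of_real) simp
    qed
    show "summable (\<lambda>n. norm (?f (int (Suc n))))"
      by (rule summable_comparison_test'[OF sq, of 0], unfold eq)
         (simp add: divide_simps power2_eq_square)
    have "(\<lambda>n. (- 1 / complex_of_nat (Suc (Suc n))) - (- 1 / complex_of_nat (Suc n))) sums (0 - (- 1 / complex_of_nat (Suc 0)))"
      by (rule telescope_sums[of "\<lambda>n. - 1 / complex_of_nat (Suc n)"]) (rule LIMSEQ_Suc[OF lim])
    thus "(\<lambda>n. ?f (int (Suc n))) sums 1" by (simp add: algebra_simps)
  qed
  moreover have "((\<lambda>n. ?f (- int (Suc n))) has_sum 0) UNIV"
  proof (rule norm_summable_imp_has_sum)
    have eq: "?f (- int (Suc n)) = (- 1 / complex_of_nat (Suc n)) - (- 1 / complex_of_nat n)" for n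
    proof -
      have "complex_of_int (- int (Suc n)) = - of_nat (Suc n)" "complex_of_int (- int (Suc n) + 1) = - of_nat n"
        by simp_all
      thus ?thesis by (simp only:) (simp del: of_nat_Suc)
    qed
    have "norm (?f (- int (Suc n))) \<le> 2 * (1 / real (Suc n) ^ 2)" for n
    proof (cases n)
      case (Suc k)
      have "1 / (real (Suc n) * real n) = - 1 / real (Suc n) - (- 1 / real n)"
        using Suc by (simp add: field_simps)
      hence "?f (- int (Suc n)) = complex_of_real (1 / (real (Suc n) * real n))"
        unfolding eq by simp
      hence "norm (?f (- int (Suc n))) = 1 / (real (Suc n) * real n)" by (simp only: norm_of_real) simp
      also have "1 / (a * b) \<le> 2 * (1 / a ^ 2)" if "a > 0" "b > 0" "a \<le> 2 * b" for a b :: real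
        using that by (simp add: field_simps power2_eq_square)
      hence "1 / (real (Suc n) * real n) \<le> 2 * (1 / real (Suc n) ^ 2)" using Suc by simp
      finally show ?thesis .
    qed simp
    thus "summable (\<lambda>n. norm (?f (- int (Suc n))))"
      by (intro summable_comparison_test'[OF sq, of 0]) simp
    have "(\<lambda>n. (- 1 / complex_of_nat (Suc n)) - (- 1 / complex_of_nat n)) sums (0 - (- 1 / complex_of_nat 0))"
      by (rule telescope_sums[of "\<lambda>n. - 1 / complex_of_nat n"]) (rule lim)
    thus "(\<lambda>n. ?f (- int (Suc n))) sums 0" unfolding eq by simp
  qed
  ultimately have "(?f has_sum (1 + 0)) (- {0})" by (rule has_sum_int_split)
  moreover have "(?f has_sum ?f 0) {0}" using has_sum_finite[of "{0}" ?f] by simp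
  ultimately have "(?f has_sum (?f 0 + (1 + 0))) ({0} \<union> - {0})" by (intro has_sum_Un_disjoint) auto
  thus ?thesis by simp
qed

lemma has_sum_telescope:
  "((\<lambda>l. 1 / complex_of_int l - 1 / of_int (l + m)) has_sum 0) UNIV"
proof -
  have nat: "((\<lambda>l. 1 / complex_of_int l - 1 / of_int (l + int k)) has_sum 0) UNIV" for k
  proof (induction k)
    case (Suc k)
    have "((\<lambda>l. 1 / complex_of_int (l + 1) - 1 / of_int (l + 1 + int k)) has_sum 0) UNIV"
      by (rule has_sum_int_shift[OF Suc]) auto
    from has_sum_add[OF has_sum_telescope_step this] show ?case by (simp add: add_ac)
  qed simp
  show ?thesis
  proof (cases "m \<ge> 0")
    case True
    thus ?thesis using nat[of "nat m"] by simp
  next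
    case False
    have "((\<lambda>l. 1 / complex_of_int (l + m) - 1 / of_int (l + m + int (nat (- m)))) has_sum 0) UNIV"
      by (rule has_sum_int_shift[OF nat]) auto
    from has_sum_uminusI[OF this] show ?thesis using False by simp
  qed
qed

text \<open>When one exponent is 0, the zeta sum runs over one integer too many, and the term
  removed is the one that \<open>zeta_int 0 = -1\<close> accounts for.\<close>

lemma has_sum_int_two_poles:
  fixes m :: int
  assumes m: "m \<noteq> 0" and pa: "p + a \<ge> 2"
  shows "((\<lambda>l. 1 / (of_int l ^ p * of_int (l + m) ^ a)) has_sum
    pole_sum (of_int m) zeta_int zeta_int p a) (- {0, - m})"
proof -
  have cm: "complex_of_int m \<noteq> 0" using m by simp
  have A: "- {0} - {- m} = - {0, - m}" "- {- m} - {0} = - {0, - m}" by auto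
  have xy: "complex_of_int l \<noteq> 0" "complex_of_int (l + m) \<noteq> 0" if "l \<in> - {0, - m}" for l
  proof -
    have "l \<noteq> 0" "l + m \<noteq> 0" using that by auto
    thus "complex_of_int l \<noteq> 0" "complex_of_int (l + m) \<noteq> 0"
      by (simp_all only: of_int_eq_0_iff not_False_eq_True)
  qed
  show ?thesis
  proof (rule has_sum_two_poles[where g = "\<lambda>_. 1"])
    fix p :: nat assume p: "p \<ge> 2"
    have "((\<lambda>l. 1 / of_int l ^ p) has_sum (zeta_int p - 1 / of_int (- m) ^ p)) (- {0} - {- m})"
      by (rule has_sum_remove[OF has_sum_zeta_int[OF p]]) (use m in auto)
    moreover have "zeta_int p - 1 / of_int (- m) ^ p = (-1) ^ p * zeta_int p + (-1) ^ p / of_int m ^ p * zeta_int 0"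
    proof -
      have "zeta_int p = 0" if "odd p" using that by (simp add: zeta_int_def)
      thus ?thesis by (cases "even p") (simp_all add: zeta_int_0)
    qed
    ultimately show "((\<lambda>l. 1 / of_int l ^ p) has_sum
        ((-1) ^ p * zeta_int p + (-1) ^ p / of_int m ^ p * zeta_int 0)) (- {0, - m})" by (simp only: A)
  next
    fix c :: nat assume c: "c \<ge> 2"
    have "((\<lambda>l. 1 / of_int (l + m) ^ c) has_sum zeta_int c) (- {- m})"
      by (rule has_sum_int_shift[OF has_sum_zeta_int[OF c]]) auto
    hence "((\<lambda>l. 1 / of_int (l + m) ^ c) has_sum (zeta_int c - 1 / of_int (0 + m) ^ c)) (- {- m} - {0})"
      by (rule has_sum_remove) (use m in auto)
    thus "((\<lambda>l. 1 / of_int (l + m) ^ c) has_sum (zeta_int c + zeta_int 0 / of_int m ^ c)) (- {0, - m})"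
      by (simp add: A zeta_int_0)
  next
    \<comment> \<open>For the exponents \<open>(1, 1)\<close> only the difference of the two series
      converges. It sums to 0 over all integers, and the finite contributions of 0 and
      \<open>- m\<close> are taken off.\<close>
    let ?f = "\<lambda>l. 1 / complex_of_int l - 1 / of_int (l + m)"
    have "(?f has_sum (0 - ?f 0 - ?f (- m))) (UNIV - {0} - {- m})"
      by (intro has_sum_remove has_sum_telescope) (use m in auto)
    from has_sum_cmult_right[OF this, of "1 / of_int m"]
    have "((\<lambda>l. 1 / of_int m * ?f l) has_sum (1 / of_int m * (0 - ?f 0 - ?f (- m)))) (- {0, - m})"
      by (simp add: Compl_eq_Diff_UNIV Diff_insert2[symmetric] insert_commute)
    moreover have "1 / of_int m * (0 - ?f 0 - ?f (- m)) = pole_sum (of_int m) zeta_int zeta_int 1 1"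
      using cm by (simp add: pole_sum_def pole_coeff_def pole_coeff'_def zeta_int_0 field_simps power2_eq_square)
         (simp add: zeta_int_def)
    moreover have "1 / of_int m * ?f l = 1 / (of_int l * of_int (l + m))" if "l \<in> - {0, - m}" for l
      using xy[OF that] cm by (simp add: divide_simps)
    ultimately show "((\<lambda>l. 1 / (of_int l * of_int (l + m))) has_sum pole_sum (of_int m) zeta_int zeta_int 1 1) (- {0, - m})"
      by (rule has_sum_transform)
    show "complex_of_int (l + m) = of_int l + of_int m" for l by simp
  qed (fact cm xy pa)+
qed

text \<open>
  Up to sign the sums of \<open>1 / (l ^ r * (l + m) ^ a)\<close>; the values at \<open>r = 0\<close> correct for the third pole,
  at which the two-pole sums still have a term.
\<close>

definition triple_coeff :: "complex \<Rightarrow> nat \<Rightarrow> nat \<Rightarrow> complex" where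
  "triple_coeff m a r = (if r = 0 then - 1 / m ^ a else (-1) ^ r * pole_sum m zeta_int zeta_int r a)"

definition triple_coeff' :: "complex \<Rightarrow> nat \<Rightarrow> nat \<Rightarrow> complex" where
  "triple_coeff' n a r = (if r = 0 then - ((-1) ^ a / n ^ a) else pole_sum n zeta_int zeta_int a r)"

text \<open>The two-pole recurrence is used for the outer poles 0 and \<open>- (m + n)\<close>, with
  the middle factor as weight; its initial values are two-pole sums with one further integer
  removed. Because of \<open>a \<ge> 1\<close> these converge already for exponent 1, so
  \<open>(1, 1)\<close> follows from the recurrence without another telescoping argument.\<close>

lemma has_sum_int_three_poles:
  fixes m n :: int
  assumes nz: "m \<noteq> 0" "n \<noteq> 0" "m + n \<noteq> 0" and a: "a \<ge> 1" and pc: "p + c \<ge> 2"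
  shows "((\<lambda>l. 1 / of_int (l + m) ^ a / (of_int l ^ p * of_int (l + m + n) ^ c)) has_sum
    pole_sum (of_int (m + n)) (triple_coeff (of_int m) a) (triple_coeff' (of_int n) a) p c) (- {0, - m, - (m + n)})"
proof -
  let ?A = "- {0, - m, - (m + n)}" and ?D = "complex_of_int (m + n)"
  let ?e = "triple_coeff (of_int m) a" and ?e' = "triple_coeff' (of_int n) a"
  have cnz: "complex_of_int m \<noteq> 0" "complex_of_int n \<noteq> 0" "?D \<noteq> 0" using nz by (auto simp del: of_int_add)
  have A: "- {0, - m} - {- (m + n)} = ?A" "- {- m, - (m + n)} - {0} = ?A" by auto
  have p: "((\<lambda>l. 1 / of_int (l + m) ^ a / of_int l ^ p) has_sum
      ((-1) ^ p * ?e p + (-1) ^ p / ?D ^ p * ?e' 0)) ?A" if p: "p \<ge> 1" for p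
  proof -
    have "((\<lambda>l. 1 / (of_int l ^ p * of_int (l + m) ^ a)) has_sum
       (pole_sum (of_int m) zeta_int zeta_int p a - 1 / (of_int (- (m + n)) ^ p * of_int (- (m + n) + m) ^ a)))
       (- {0, - m} - {- (m + n)})"
      by (rule has_sum_remove[OF has_sum_int_two_poles]) (use nz a p in auto)
    moreover have "1 / (of_int (- (m + n)) ^ p * of_int (- (m + n) + m) ^ a) = - ((-1) ^ p / ?D ^ p * ?e' 0)"
    proof -
      have "of_int (- (m + n)) ^ p = (-1) ^ p * ?D ^ p"
        by (subst power_mult_distrib[symmetric]) simp
      moreover have "of_int (- (m + n) + m) ^ a = (-1) ^ a * complex_of_int n ^ a"
        by (subst power_mult_distrib[symmetric]) simp
      ultimately show ?thesis
        by (cases "even p"; cases "even a") (simp_all add: triple_coeff'_def del: of_int_minus of_int_add)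
    qed
    ultimately show ?thesis unfolding A using p
      by (simp add: triple_coeff_def mult.commute mult.assoc flip: power_mult_distrib)
  qed
  have c: "((\<lambda>l. 1 / of_int (l + m) ^ a / of_int (l + m + n) ^ c) has_sum (?e' c + ?e 0 / ?D ^ c)) ?A"
    if c: "c \<ge> 1" for c
  proof -
    have "((\<lambda>l. 1 / (of_int (l + m) ^ a * of_int (l + m + n) ^ c)) has_sum
        pole_sum (of_int n) zeta_int zeta_int a c) (- {- m, - (m + n)})"
      by (rule has_sum_int_shift[OF has_sum_int_two_poles]) (use nz a c in auto)
    hence "((\<lambda>l. 1 / (of_int (l + m) ^ a * of_int (l + m + n) ^ c)) has_sum
        (pole_sum (of_int n) zeta_int zeta_int a c - 1 / (of_int (0 + m) ^ a * of_int (0 + m + n) ^ c)))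
        (- {- m, - (m + n)} - {0})"
      by (rule has_sum_remove) (use nz in auto)
    thus ?thesis unfolding A using c by (simp add: triple_coeff_def triple_coeff'_def)
  qed
  have x: "complex_of_int l \<noteq> 0" "complex_of_int (l + m + n) \<noteq> 0" if "l \<in> ?A" for l
    using that by (auto simp del: of_int_add)
  have D: "complex_of_int (l + m + n) = of_int l + ?D" for l by simp
  show ?thesis
  proof (rule has_sum_two_poles[OF cnz(3) D x p c _ pc])
    have "((\<lambda>l. 1 / ?D * (1 / of_int (l + m) ^ a / of_int l ^ 1 - 1 / of_int (l + m) ^ a / of_int (l + m + n) ^ 1)) has_sum
       (1 / ?D * (((-1) ^ 1 * ?e 1 + (-1) ^ 1 / ?D ^ 1 * ?e' 0) - (?e' 1 + ?e 0 / ?D ^ 1)))) ?A"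
      by (intro has_sum_cmult_right has_sum_diff p c) auto
    moreover have "1 / ?D * (((-1) ^ 1 * ?e 1 + (-1) ^ 1 / ?D ^ 1 * ?e' 0) - (?e' 1 + ?e 0 / ?D ^ 1)) = pole_sum ?D ?e ?e' 1 1"
      using cnz by (simp only: pole_sum_rec[OF cnz(3)] One_nat_def pole_sum_0_right pole_sum_0_left zero_less_Suc) simp
    moreover have "1 / ?D * (1 / of_int (l + m) ^ a / of_int l ^ 1 - 1 / of_int (l + m) ^ a / of_int (l + m + n) ^ 1) =
       1 / of_int (l + m) ^ a / (of_int l * of_int (l + m + n))" if l: "l \<in> ?A" for l
    proof -
      have "1 / complex_of_int l - 1 / of_int (l + m + n) = ?D / (of_int l * of_int (l + m + n))"
      proof -
        have "complex_of_int (l + m + n) - of_int l = ?D" by simp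
        thus ?thesis using diff_frac_eq[OF x[OF l], of 1 1] by (simp del: of_int_add)
      qed
      hence "1 / ?D * (1 / complex_of_int l - 1 / of_int (l + m + n)) = 1 / (of_int l * of_int (l + m + n))"
        using cnz(3) by (simp del: of_int_add)
      moreover have "1 / d * (M / x ^ 1 - M / y ^ 1) = M / (x * y)" if "1 / d * (1 / x - 1 / y) = 1 / (x * y)"
        for d M x y :: complex
      proof -
        have "1 / d * (M / x ^ 1 - M / y ^ 1) = M * (1 / d * (1 / x - 1 / y))"
          by (simp add: divide_inverse algebra_simps)
        thus ?thesis unfolding that by simp
      qed
      ultimately show ?thesis by blast
    qed
    ultimately show "((\<lambda>l. 1 / of_int (l + m) ^ a / (of_int l * of_int (l + m + n))) has_sum pole_sum ?D ?e ?e' 1 1) ?A"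
      by (rule has_sum_transform)
  qed simp_all
qed

text \<open>\<open>pole_sum\<close> of zeta values without its sign, with the binomial coefficients
  turned into the shape of the theorem. The second sum is cut off at \<open>r = 0\<close>, where
  \<open>r - 1\<close> would truncate; the first then leaves \<open>zeta_int 0 / m ^ a\<close>, the
  correction required in \<open>triple_coeff\<close>.\<close>

definition pole_expansion :: "complex \<Rightarrow> nat \<Rightarrow> nat \<Rightarrow> complex" where
  "pole_expansion m a r = (\<Sum>k\<le>r. of_nat ((r - k + a - 1) choose (r - k)) * zeta_int k / m ^ (a + (r - k)))
     + (if r = 0 then 0 else \<Sum>k\<le>a. of_nat ((r - 1 + (a - k)) choose (r - 1)) * zeta_int k / m ^ (a - k + r))"

lemma pole_sum_zeta:
  assumes "p \<ge> 1" "a \<ge> 1"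
  shows "pole_sum m zeta_int zeta_int p a = (-1) ^ p * pole_expansion m a p"
proof -
  have "(\<Sum>k\<le>p. pole_coeff m p a k * zeta_int k) =
      (-1) ^ p * (\<Sum>k\<le>p. of_nat ((p - k + a - 1) choose (p - k)) * zeta_int k / m ^ (a + (p - k)))"
    unfolding sum_distrib_left
    by (intro sum.cong refl) (use assms in \<open>auto simp: pole_coeff_def add.commute\<close>)
  moreover have "(\<Sum>k\<le>a. pole_coeff' m p a k * zeta_int k) =
      (-1) ^ p * (\<Sum>k\<le>a. of_nat ((p - 1 + (a - k)) choose (p - 1)) * zeta_int k / m ^ (a - k + p))"
    unfolding sum_distrib_left
  proof (intro sum.cong refl)
    fix k assume k: "k \<in> {..a}"
    have "(p + a - 1 - k) choose (a - k) = (p - 1 + (a - k)) choose (p - 1)"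
      using binomial_symmetric[of "p - 1" "p - 1 + (a - k)"] k assms by simp
    moreover have "p + a - k = a - k + p" using k by simp
    ultimately show "pole_coeff' m p a k * zeta_int k =
      (-1) ^ p * (of_nat ((p - 1 + (a - k)) choose (p - 1)) * zeta_int k / m ^ (a - k + p))"
      using k by (simp add: pole_coeff'_def)
  qed
  ultimately show ?thesis using assms by (simp add: pole_sum_def pole_expansion_def algebra_simps)
qed

lemma pole_expansion_0: "pole_expansion m a 0 = - 1 / m ^ a"
  by (simp add: pole_expansion_def zeta_int_0)

lemma triple_coeff_eq:
  assumes "a \<ge> 1"
  shows "triple_coeff m a r = pole_expansion m a r"
  using pole_sum_zeta[of r a m] assms
  by (cases "even r") (auto simp: triple_coeff_def pole_expansion_0)

text \<open>This mirrors the reflection of \<open>l\<close> to \<open>- l - m\<close>, which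
  exchanges the two poles and changes the summand by \<open>(-1) ^ (p + a)\<close>.\<close>

lemma pole_sum_zeta_swap:
  "(-1) ^ a * pole_sum m zeta_int zeta_int p a = (-1) ^ p * pole_sum m zeta_int zeta_int a p"
proof -
  have "(-1) ^ a * pole_coeff m p a k = (-1) ^ p * pole_coeff' m a p k"
       "(-1) ^ a * pole_coeff' m p a k = (-1) ^ p * pole_coeff m a p k" for k
    by (auto simp: pole_coeff_def pole_coeff'_def add.commute)
  thus ?thesis
    by (simp only: pole_sum_def distrib_left sum_distrib_left mult.assoc[symmetric] add.commute)
qed

lemma triple_coeff'_eq:
  assumes "a \<ge> 1"
  shows "triple_coeff' n a r = (-1) ^ a * pole_expansion n a r"
proof (cases "r = 0")
  case False
  have "(-1) ^ r * pole_sum n zeta_int zeta_int a r = (-1) ^ a * ((-1) ^ r * pole_expansion n a r)"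
    using pole_sum_zeta_swap[of r n a] pole_sum_zeta[of r a n] False assms by simp
  hence "pole_sum n zeta_int zeta_int a r = (-1) ^ a * pole_expansion n a r"
    by (cases "even r") auto
  thus ?thesis using False by (simp add: triple_coeff'_def)
qed (simp add: triple_coeff'_def pole_expansion_0)

lemma sum_zeta_int:
  "(\<Sum>k\<le>n. zeta_int k * G k) = 2 * (\<Sum>j=0..n div 2. riemann_zeta (of_nat (2 * j)) * G (2 * j))"
proof -
  have "(\<Sum>k\<le>n. zeta_int k * G k) = (\<Sum>k\<in>(*) 2 ` {0..n div 2}. zeta_int k * G k)"
  proof (rule sum.mono_neutral_right)
    have "k \<in> (*) 2 ` {0..n div 2}" if "k \<le> n" "even k" for k
      using that by (intro image_eqI[of _ _ "k div 2"]) auto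
    thus "\<forall>k\<in>{..n} - (*) 2 ` {0..n div 2}. zeta_int k * G k = 0" by (auto simp: zeta_int_def)
  qed auto
  also have "\<dots> = (\<Sum>j=0..n div 2. zeta_int (2 * j) * G (2 * j))"
    by (subst sum.reindex) (auto simp: inj_on_def)
  finally show ?thesis by (simp add: zeta_int_def sum_distrib_left mult.assoc)
qed

lemma sum_triangle:
  fixes g :: "nat \<Rightarrow> nat \<Rightarrow> 'a::comm_monoid_add"
  shows "(\<Sum>r\<le>p. \<Sum>k\<le>r. g k (r - k)) = (\<Sum>k\<le>p. \<Sum>w=0..p - k. g k w)"
proof -
  have "(\<Sum>r\<le>p. \<Sum>k\<le>r. g k (r - k)) = sum (\<lambda>(i, j). g i j) {(i, j). i + j \<le> p}"
    by (rule sum.triangle_reindex_eq[symmetric])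
  also have "{(i, j). i + j \<le> p} = Sigma {..p} (\<lambda>k. {0..p - k})" by auto
  finally show ?thesis by (simp add: sum.Sigma)
qed

text \<open>In the first half, \<open>r = k + \<omega>\<close> turns the sum over
  \<open>k \<le> r \<le> p\<close> into one over \<open>k\<close> outside and
  \<open>\<omega>\<close> inside; in the second, \<open>r = \<omega> + 1\<close>. Odd
  \<open>k\<close> drop out, which leaves \<open>k = 2 * j\<close>.\<close>

lemma pole_expansion_sum:
  assumes "p \<ge> 1" "c \<ge> 1" "a \<ge> 1"
  shows "(\<Sum>r\<le>p. pole_coeff D p c r * pole_expansion m a r) =
      2 * (-1) ^ p * (\<Sum>j=0..p div 2. riemann_zeta (of_nat (2 * j)) *
        (\<Sum>\<omega>=0..p - 2 * j. of_nat ((\<omega> + a - 1) choose \<omega>) * of_nat ((p + c - 2 * j - \<omega> - 1) choose (c - 1)) *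
           (1 / (m ^ (a + \<omega>) * D ^ (p + c - 2 * j - \<omega>)))))
    + 2 * (-1) ^ p * (\<Sum>j=0..a div 2. riemann_zeta (of_nat (2 * j)) *
        (\<Sum>\<omega>=0..p - 1. of_nat ((\<omega> + a - 2 * j) choose \<omega>) * of_nat ((p + c - 2 - \<omega>) choose (c - 1)) *
           (1 / (m ^ (a - 2 * j + \<omega> + 1) * D ^ (p + c - 1 - \<omega>)))))"
proof -
  \<comment> \<open>The lower index \<open>c - 1\<close> comes from the symmetry of binomial
    coefficients, which needs \<open>r \<le> p\<close>. In this form \<open>B\<close> depends on
    \<open>r\<close> only through differences that survive the reindexing.\<close>
  define B where "B r = of_nat ((p + c - 1 - r) choose (c - 1)) / D ^ (p + c - r)" for r
  have coeff: "pole_coeff D p c r = (-1) ^ p * B r" if "r \<le> p" for r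
    using that assms binomial_symmetric[of "c - 1" "p + c - 1 - r"] by (simp add: pole_coeff_def B_def)
  define g where "g k w = zeta_int k * (of_nat ((w + a - 1) choose w) * B (k + w) / m ^ (a + w))" for k w
  have 1: "(\<Sum>r\<le>p. B r * (\<Sum>k\<le>r. of_nat ((r - k + a - 1) choose (r - k)) * zeta_int k / m ^ (a + (r - k)))) =
     2 * (\<Sum>j=0..p div 2. riemann_zeta (of_nat (2 * j)) *
        (\<Sum>\<omega>=0..p - 2 * j. of_nat ((\<omega> + a - 1) choose \<omega>) * of_nat ((p + c - 2 * j - \<omega> - 1) choose (c - 1)) *
           (1 / (m ^ (a + \<omega>) * D ^ (p + c - 2 * j - \<omega>)))))"
  proof -
    have "(\<Sum>r\<le>p. B r * (\<Sum>k\<le>r. of_nat ((r - k + a - 1) choose (r - k)) * zeta_int k / m ^ (a + (r - k)))) =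
      (\<Sum>r\<le>p. \<Sum>k\<le>r. g k (r - k))"
      unfolding sum_distrib_left by (intro sum.cong refl) (simp add: g_def)
    also have "\<dots> = (\<Sum>k\<le>p. \<Sum>w=0..p - k. g k w)" by (rule sum_triangle)
    also have "\<dots> = (\<Sum>k\<le>p. zeta_int k * (\<Sum>w=0..p - k. of_nat ((w + a - 1) choose w) * B (k + w) / m ^ (a + w)))"
      by (simp only: g_def sum_distrib_left)
    also have "\<dots> = 2 * (\<Sum>j=0..p div 2. riemann_zeta (of_nat (2 * j)) *
        (\<Sum>w=0..p - 2 * j. of_nat ((w + a - 1) choose w) * B (2 * j + w) / m ^ (a + w)))"
      by (rule sum_zeta_int)
    also have "(\<lambda>j w. of_nat ((w + a - 1) choose w) * B (2 * j + w) / m ^ (a + w)) =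
       (\<lambda>j w. of_nat ((w + a - 1) choose w) * of_nat ((p + c - 2 * j - w - 1) choose (c - 1)) *
           (1 / (m ^ (a + w) * D ^ (p + c - 2 * j - w))))"
    proof (intro ext)
      fix j w
      have "p + c - 1 - (2 * j + w) = p + c - 2 * j - w - 1" "p + c - (2 * j + w) = p + c - 2 * j - w" by auto
      thus "of_nat ((w + a - 1) choose w) * B (2 * j + w) / m ^ (a + w) =
        of_nat ((w + a - 1) choose w) * of_nat ((p + c - 2 * j - w - 1) choose (c - 1)) *
           (1 / (m ^ (a + w) * D ^ (p + c - 2 * j - w)))"
        unfolding B_def by (simp only: times_divide_eq_left times_divide_eq_right divide_divide_eq_left mult_1_right) (simp add: mult.commute)
    qed
    finally show ?thesis .
  qed
  have 2: "(\<Sum>r\<le>p. B r * (if r = 0 then 0 else \<Sum>k\<le>a. of_nat ((r - 1 + (a - k)) choose (r - 1)) * zeta_int k / m ^ (a - k + r))) =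
     2 * (\<Sum>j=0..a div 2. riemann_zeta (of_nat (2 * j)) *
        (\<Sum>\<omega>=0..p - 1. of_nat ((\<omega> + a - 2 * j) choose \<omega>) * of_nat ((p + c - 2 - \<omega>) choose (c - 1)) *
           (1 / (m ^ (a - 2 * j + \<omega> + 1) * D ^ (p + c - 1 - \<omega>)))))"
  proof -
    obtain p' where p': "p = Suc p'" using assms by (cases p) auto
    have "(\<Sum>r\<le>p. B r * (if r = 0 then 0 else \<Sum>k\<le>a. of_nat ((r - 1 + (a - k)) choose (r - 1)) * zeta_int k / m ^ (a - k + r))) =
      (\<Sum>w\<le>p'. B (Suc w) * (\<Sum>k\<le>a. of_nat ((w + (a - k)) choose w) * zeta_int k / m ^ (a - k + Suc w)))"
      unfolding p' by (subst sum.atMost_Suc_shift) simp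
    also have "\<dots> = (\<Sum>k\<le>a. zeta_int k * (\<Sum>w\<le>p'. of_nat ((w + (a - k)) choose w) * B (Suc w) / m ^ (a - k + Suc w)))"
      unfolding sum_distrib_left by (subst sum.swap) (intro sum.cong refl, simp)
    also have "\<dots> = 2 * (\<Sum>j=0..a div 2. riemann_zeta (of_nat (2 * j)) *
        (\<Sum>w\<le>p'. of_nat ((w + (a - 2 * j)) choose w) * B (Suc w) / m ^ (a - 2 * j + Suc w)))"
      by (rule sum_zeta_int)
    also have "(\<Sum>j=0..a div 2. riemann_zeta (of_nat (2 * j)) *
        (\<Sum>w\<le>p'. of_nat ((w + (a - 2 * j)) choose w) * B (Suc w) / m ^ (a - 2 * j + Suc w))) =
       (\<Sum>j=0..a div 2. riemann_zeta (of_nat (2 * j)) *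
        (\<Sum>\<omega>=0..p - 1. of_nat ((\<omega> + a - 2 * j) choose \<omega>) * of_nat ((p + c - 2 - \<omega>) choose (c - 1)) *
           (1 / (m ^ (a - 2 * j + \<omega> + 1) * D ^ (p + c - 1 - \<omega>)))))"
    proof (intro sum.cong refl arg_cong2[of _ _ _ _ "(*)"])
      fix j w assume j: "j \<in> {0..a div 2}" and w: "w \<in> {0..p - 1}"
      have "w + (a - 2 * j) = w + a - 2 * j" "p + c - 1 - Suc w = p + c - 2 - w" "p + c - Suc w = p + c - 1 - w"
        using j by auto
      thus "of_nat ((w + (a - 2 * j)) choose w) * B (Suc w) / m ^ (a - 2 * j + Suc w) =
        of_nat ((w + a - 2 * j) choose w) * of_nat ((p + c - 2 - w) choose (c - 1)) *
           (1 / (m ^ (a - 2 * j + w + 1) * D ^ (p + c - 1 - w)))"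
        unfolding B_def by (simp only: times_divide_eq_left times_divide_eq_right divide_divide_eq_left mult_1_right) (simp add: mult.commute)
    qed (simp add: p' atLeast0AtMost)
    finally show ?thesis .
  qed
  have "(\<Sum>r\<le>p. pole_coeff D p c r * pole_expansion m a r) = (\<Sum>r\<le>p. (-1) ^ p * (B r * pole_expansion m a r))"
    by (intro sum.cong refl) (simp add: coeff)
  also have "\<dots> = (-1) ^ p * (\<Sum>r\<le>p. B r * pole_expansion m a r)"
    by (simp only: sum_distrib_left)
  also have "(\<Sum>r\<le>p. B r * pole_expansion m a r) =
    (\<Sum>r\<le>p. B r * (\<Sum>k\<le>r. of_nat ((r - k + a - 1) choose (r - k)) * zeta_int k / m ^ (a + (r - k)))) +
    (\<Sum>r\<le>p. B r * (if r = 0 then 0 else \<Sum>k\<le>a. of_nat ((r - 1 + (a - k)) choose (r - 1)) * zeta_int k / m ^ (a - k + r)))"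
    by (simp only: pole_expansion_def distrib_left sum.distrib)
  finally show ?thesis unfolding 1 2 by (simp only: distrib_left mult.assoc mult.left_commute[of "(-1) ^ p" 2])
qed

lemma three_pole_sum_expansion:
  assumes "p \<ge> 1" "c \<ge> 1" "a \<ge> 1"
  shows "pole_sum D (triple_coeff m a) (triple_coeff' n a) p c =
      2 * (-1) ^ p * (\<Sum>j=0..p div 2. riemann_zeta (of_nat (2 * j)) *
        (\<Sum>\<omega>=0..p - 2 * j. of_nat ((\<omega> + a - 1) choose \<omega>) * of_nat ((p + c - 2 * j - \<omega> - 1) choose (c - 1)) *
           (1 / (m ^ (a + \<omega>) * D ^ (p + c - 2 * j - \<omega>)))))
    + 2 * (-1) ^ (p + a) * (\<Sum>j=0..c div 2. riemann_zeta (of_nat (2 * j)) *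
        (\<Sum>\<omega>=0..c - 2 * j. of_nat ((\<omega> + a - 1) choose \<omega>) * of_nat ((p + c - 2 * j - \<omega> - 1) choose (p - 1)) *
           (1 / (n ^ (a + \<omega>) * D ^ (p + c - 2 * j - \<omega>)))))
    + 2 * (-1) ^ p * (\<Sum>j=0..a div 2. riemann_zeta (of_nat (2 * j)) *
        (\<Sum>\<omega>=0..p - 1. of_nat ((\<omega> + a - 2 * j) choose \<omega>) * of_nat ((p + c - 2 - \<omega>) choose (c - 1)) *
           (1 / (m ^ (a - 2 * j + \<omega> + 1) * D ^ (p + c - 1 - \<omega>)))))
    + 2 * (-1) ^ (p + a) * (\<Sum>j=0..a div 2. riemann_zeta (of_nat (2 * j)) *
        (\<Sum>\<omega>=0..c - 1. of_nat ((\<omega> + a - 2 * j) choose \<omega>) * of_nat ((p + c - 2 - \<omega>) choose (p - 1)) *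
           (1 / (n ^ (a - 2 * j + \<omega> + 1) * D ^ (p + c - \<omega> - 1)))))"
proof -
  have sq: "(-1) ^ c * (-1) ^ c = (1 :: complex)" by (simp flip: power_mult_distrib)
  \<comment> \<open>The second pole is the first with \<open>p\<close> and \<open>c\<close>
    exchanged, up to sign. The resulting \<open>(-1) ^ c\<close> meets the one in
    \<open>pole_expansion_sum\<close> and cancels; the factor \<open>(-1) ^ a\<close> comes from
    \<open>triple_coeff'\<close>.\<close>
  have "pole_coeff' D p c r = (-1) ^ p * (-1) ^ c * pole_coeff D c p r" for r
    using sq by (simp add: pole_coeff_def pole_coeff'_def add.commute)
  hence "(\<Sum>r\<le>c. pole_coeff' D p c r * triple_coeff' n a r) =
     (-1) ^ (p + a) * (-1) ^ c * (\<Sum>r\<le>c. pole_coeff D c p r * pole_expansion n a r)"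
    unfolding triple_coeff'_eq[OF assms(3)] sum_distrib_left power_add
    by (intro sum.cong refl) simp
  also have "\<dots> = (-1) ^ (p + a) * (-1) ^ c * (2 * (-1) ^ c * (\<Sum>j=0..c div 2. riemann_zeta (of_nat (2 * j)) *
        (\<Sum>\<omega>=0..c - 2 * j. of_nat ((\<omega> + a - 1) choose \<omega>) * of_nat ((p + c - 2 * j - \<omega> - 1) choose (p - 1)) *
           (1 / (n ^ (a + \<omega>) * D ^ (p + c - 2 * j - \<omega>)))))
    + 2 * (-1) ^ c * (\<Sum>j=0..a div 2. riemann_zeta (of_nat (2 * j)) *
        (\<Sum>\<omega>=0..c - 1. of_nat ((\<omega> + a - 2 * j) choose \<omega>) * of_nat ((p + c - 2 - \<omega>) choose (p - 1)) *
           (1 / (n ^ (a - 2 * j + \<omega> + 1) * D ^ (p + c - \<omega> - 1))))))"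
    by (subst pole_expansion_sum) (use assms in \<open>simp_all only: add.commute[of c p] diff_commute[of "p + c" _ 1]\<close>)
  also have "s * ((-1) ^ c) * (2 * (-1) ^ c * x + 2 * (-1) ^ c * y) = 2 * s * x + 2 * s * y" for s x y :: complex
  proof -
    have "s * ((-1) ^ c) * (2 * (-1) ^ c * x + 2 * (-1) ^ c * y) = ((-1) ^ c * (-1) ^ c) * (2 * s * x + 2 * s * y)"
      by (simp only: algebra_simps)
    thus ?thesis unfolding sq by simp
  qed
  finally have 2: "(\<Sum>r\<le>c. pole_coeff' D p c r * triple_coeff' n a r) =
    2 * (-1) ^ (p + a) * (\<Sum>j=0..c div 2. riemann_zeta (of_nat (2 * j)) *
        (\<Sum>\<omega>=0..c - 2 * j. of_nat ((\<omega> + a - 1) choose \<omega>) * of_nat ((p + c - 2 * j - \<omega> - 1) choose (p - 1)) *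
           (1 / (n ^ (a + \<omega>) * D ^ (p + c - 2 * j - \<omega>)))))
    + 2 * (-1) ^ (p + a) * (\<Sum>j=0..a div 2. riemann_zeta (of_nat (2 * j)) *
        (\<Sum>\<omega>=0..c - 1. of_nat ((\<omega> + a - 2 * j) choose \<omega>) * of_nat ((p + c - 2 - \<omega>) choose (p - 1)) *
           (1 / (n ^ (a - 2 * j + \<omega> + 1) * D ^ (p + c - \<omega> - 1)))))" .
  show ?thesis
    unfolding pole_sum_def 2 triple_coeff_eq[OF assms(3)] pole_expansion_sum[OF assms] by (simp only: add_ac)
qed

section \<open>Weyl chambers\<close>

text \<open>A product of six inverses, not one fraction, so that on a chamber each factor is
  rewritten on its own, with its own sign.\<close>

definition root_term :: "nat \<Rightarrow> nat \<Rightarrow> complex \<Rightarrow> nat \<Rightarrow> nat \<Rightarrow> nat \<Rightarrow> int \<times> int \<times> int \<Rightarrow> complex" where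
  "root_term p q s a b c = (\<lambda>(l, m, n). inverse (of_int l ^ p) * inverse (of_int m ^ q) * inverse (of_int n powr s) *
     inverse (of_int (l + m) ^ a) * inverse (of_int (m + n) ^ b) * inverse (of_int (l + m + n) ^ c))"

lemmas root_term_simps =
  root_term_def A3_term_def prod.case vector_6 power_add power_0 mult_1 divide_inverse inverse_mult_distrib

lemma inverse_int_power_pos:
  "x > 0 \<Longrightarrow> inverse (complex_of_int x ^ e) = inverse (of_nat (nat x) powr of_nat e)"
  by (subst powr_nat') (auto simp: of_nat_nat)

lemma inverse_int_power_neg:
  assumes "- x > 0"
  shows "inverse (complex_of_int x ^ e) = (-1) ^ e * inverse (of_nat (nat (- x)) powr of_nat e)"
proof -
  have "inverse (complex_of_int x ^ e) = (-1) ^ e * inverse (of_int (- x) ^ e)"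
    by (cases "even e") auto
  thus ?thesis using inverse_int_power_pos[OF assms] by simp
qed

lemma inverse_int_powr_pos: "x > 0 \<Longrightarrow> inverse (complex_of_int x powr s) = inverse (of_nat (nat x) powr s)"
  by (simp add: of_nat_nat)

text \<open>The forms \<open>f\<close>, \<open>g\<close>, \<open>h\<close> are the simple roots of a
  chamber and serve as its positive coordinates; \<open>i\<close> expresses \<open>(l, m, n)\<close>
  through them. The sign collects the roots that are negative on the chamber.\<close>

lemma chamber_has_sum:
  fixes f g h :: "int \<Rightarrow> int \<Rightarrow> int \<Rightarrow> int"
  assumes "(A3_term z has_sum v) ({1..} \<times> {1..} \<times> {1..})"
    and "\<And>l m n. f l m n > 0 \<Longrightarrow> g l m n > 0 \<Longrightarrow> h l m n > 0 \<Longrightarrow> i (f l m n, g l m n, h l m n) = (l, m, n)"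
    and "\<And>x y t. f (fst (i (x, y, t))) (fst (snd (i (x, y, t)))) (snd (snd (i (x, y, t)))) = x \<and>
         g (fst (i (x, y, t))) (fst (snd (i (x, y, t)))) (snd (snd (i (x, y, t)))) = y \<and>
         h (fst (i (x, y, t))) (fst (snd (i (x, y, t)))) (snd (snd (i (x, y, t)))) = t"
    and R: "\<And>l m n. f l m n > 0 \<Longrightarrow> g l m n > 0 \<Longrightarrow> h l m n > 0 \<Longrightarrow>
         R (l, m, n) = (-1) ^ k * A3_term z (nat (f l m n), nat (g l m n), nat (h l m n))"
  shows "(R has_sum ((-1) ^ k * v)) {(l, m, n). f l m n > 0 \<and> g l m n > 0 \<and> h l m n > 0}"
proof -
  have "((\<lambda>x. (-1) ^ k * A3_term z x) has_sum ((-1) ^ k * v)) ({1..} \<times> {1..} \<times> {1..})"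
    by (intro has_sum_cmult_right assms)
  also have "?this \<longleftrightarrow> ?thesis"
    by (rule has_sum_reindex_bij_witness[symmetric,
          of _ "\<lambda>(x, y, t). i (int x, int y, int t)" "\<lambda>(l, m, n). (nat (f l m n), nat (g l m n), nat (h l m n))"])
       (use assms(2,3) in \<open>auto simp: R split: prod.splits\<close>, (metis fst_conv snd_conv of_nat_0_less_iff less_eq_Suc_le nat_int)+)
  finally show ?thesis .
qed

lemma has_sum_disj:
  fixes f :: "_ \<Rightarrow> complex"
  assumes "(f has_sum x) {(l, m, n). P l m n}" "(f has_sum y) {(l, m, n). Q l m n}"
    and "\<And>l m n. P l m n \<Longrightarrow> Q l m n \<Longrightarrow> False"
  shows "(f has_sum (x + y)) {(l, m, n). P l m n \<or> Q l m n}"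
proof -
  have "{(l, m, n). P l m n \<or> Q l m n} = {(l, m, n). P l m n} \<union> {(l, m, n). Q l m n}" by auto
  thus ?thesis using has_sum_Un_disjoint[OF assms(1,2)] assms(3) by auto
qed

definition regular_points :: "(int \<times> int \<times> int) set" where
  "regular_points = {(l, m, n). l \<noteq> 0 \<and> m \<noteq> 0 \<and> n > 0 \<and> l + m \<noteq> 0 \<and> m + n \<noteq> 0 \<and> l + m + n \<noteq> 0}"

lemma regular_points_chambers:
  "regular_points = {(l, m, n). (l > 0 \<and> m > 0 \<and> n > 0) \<or>
     (-l > 0 \<and> l + m > 0 \<and> n > 0) \<or>
     (m > 0 \<and> -(l + m) > 0 \<and> l + m + n > 0) \<or>
     (m > 0 \<and> n > 0 \<and> -(l + m + n) > 0) \<or>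
     (l + m > 0 \<and> -m > 0 \<and> m + n > 0) \<or>
     (l + m > 0 \<and> n > 0 \<and> -(m + n) > 0) \<or>
     (-(l + m) > 0 \<and> l > 0 \<and> m + n > 0) \<or>
     (-(l + m) > 0 \<and> l + m + n > 0 \<and> -(m + n) > 0) \<or>
     (n > 0 \<and> -(l + m + n) > 0 \<and> l > 0) \<or>
     (-m > 0 \<and> -l > 0 \<and> l + m + n > 0) \<or>
     (-m > 0 \<and> m + n > 0 \<and> -(l + m + n) > 0) \<or>
     (n > 0 \<and> -(m + n) > 0 \<and> -l > 0)}"
  proof -
  have "l \<noteq> 0 \<and> m \<noteq> 0 \<and> n > 0 \<and> l + m \<noteq> 0 \<and> m + n \<noteq> 0 \<and> l + m + n \<noteq> 0 \<longleftrightarrow>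
    (l > 0 \<and> m > 0 \<and> n > 0) \<or> (-l > 0 \<and> l + m > 0 \<and> n > 0) \<or> (m > 0 \<and> -(l + m) > 0 \<and> l + m + n > 0) \<or> (m > 0 \<and> n > 0 \<and> -(l + m + n) > 0) \<or> (l + m > 0 \<and> -m > 0 \<and> m + n > 0) \<or> (l + m > 0 \<and> n > 0 \<and> -(m + n) > 0) \<or> (-(l + m) > 0 \<and> l > 0 \<and> m + n > 0) \<or> (-(l + m) > 0 \<and> l + m + n > 0 \<and> -(m + n) > 0) \<or> (n > 0 \<and> -(l + m + n) > 0 \<and> l > 0) \<or> (-m > 0 \<and> -l > 0 \<and> l + m + n > 0) \<or> (-m > 0 \<and> m + n > 0 \<and> -(l + m + n) > 0) \<or> (n > 0 \<and> -(m + n) > 0 \<and> -l > 0)" for l m n :: int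
    by (smt (verit))
  thus ?thesis unfolding regular_points_def by simp
qed

text \<open>On each chamber the simple roots \<open>x\<close>, \<open>y\<close>, \<open>t\<close>
  and the sums \<open>x + y\<close>, \<open>y + t\<close>, \<open>x + y + t\<close> are the absolute
  values of the six linear forms. Reading off their exponents in this order gives the argument
  vector, and the exponents of the negative forms add up to that of the sign.\<close>

lemma has_sum_root_term:
  assumes "\<And>k z. (k, z) \<in> set (S_terms p q a b c s) \<Longrightarrow> (A3_term z has_sum F z) ({1..} \<times> {1..} \<times> {1..})"
  shows "(root_term p q s a b c has_sum S_sum F p q a b c s) regular_points"
proof -
  have 1: "(root_term p q s a b c has_sum ((-1) ^ 0 * F (vector [of_nat p, of_nat q, s, of_nat a, of_nat b, of_nat c]))) {(l, m, n). l > 0 \<and> m > 0 \<and> n > 0}"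
  proof -
    let ?z = "vector [of_nat p, of_nat q, s, of_nat a, of_nat b, of_nat c] :: complex ^ 6"
    show ?thesis
    proof (rule chamber_has_sum[where i = "\<lambda>(x, y, t). (x, y, t)"])
      show "(A3_term ?z has_sum F ?z) ({1..} \<times> {1..} \<times> {1..})"
        by (rule assms[of "0"]) (simp add: S_terms_def Let_def)
      fix l m n :: int
      assume *: "l > 0" "m > 0" "n > 0"
      have sum: "nat l + nat m = nat (l + m)" "nat m + nat n = nat (m + n)" "nat (l + m) + nat n = nat (l + m + n)"
        using * by simp_all
      have pos: "l + m > 0" "m + n > 0" "l + m + n > 0" using * by simp_all
      show "root_term p q s a b c (l, m, n) = (-1) ^ 0 * A3_term ?z (nat l, nat m, nat n)"
        by (simp only: root_term_simps sum
           inverse_int_power_pos[OF *(1)] inverse_int_power_pos[OF *(2)] inverse_int_powr_pos[OF *(3)] inverse_int_power_pos[OF pos(1)] inverse_int_power_pos[OF pos(2)] inverse_int_power_pos[OF pos(3)] mult_ac)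
    qed auto
  qed
  have 2: "(root_term p q s a b c has_sum ((-1) ^ p * F (vector [of_nat p, of_nat a, s, of_nat q, of_nat c, of_nat b]))) {(l, m, n). -l > 0 \<and> l + m > 0 \<and> n > 0}"
  proof -
    let ?z = "vector [of_nat p, of_nat a, s, of_nat q, of_nat c, of_nat b] :: complex ^ 6"
    show ?thesis
    proof (rule chamber_has_sum[where i = "\<lambda>(x, y, t). (-x, x + y, t)"])
      show "(A3_term ?z has_sum F ?z) ({1..} \<times> {1..} \<times> {1..})"
        by (rule assms[of "p"]) (simp add: S_terms_def Let_def)
      fix l m n :: int
      assume *: "-l > 0" "l + m > 0" "n > 0"
      have sum: "nat (-l) + nat (l + m) = nat m" "nat (l + m) + nat n = nat (l + m + n)" "nat m + nat n = nat (m + n)"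
        using * by simp_all
      have pos: "m > 0" "l + m + n > 0" "m + n > 0" using * by simp_all
      show "root_term p q s a b c (l, m, n) = (-1) ^ p * A3_term ?z (nat (-l), nat (l + m), nat n)"
        by (simp only: root_term_simps sum
           inverse_int_power_neg[OF *(1)] inverse_int_power_pos[OF *(2)] inverse_int_powr_pos[OF *(3)] inverse_int_power_pos[OF pos(1)] inverse_int_power_pos[OF pos(2)] inverse_int_power_pos[OF pos(3)] mult_ac)
    qed auto
  qed
  \<comment> \<open>For example, \<open>l\<close> and \<open>l + m\<close> are negative here, whence
    the sign exponent \<open>p + a\<close>; \<open>n\<close> is the sum of the second and third
    simple root, so \<open>s\<close> moves to the fifth place.\<close>
  have 3: "(root_term p q s a b c has_sum ((-1) ^ (p + a) * F (vector [of_nat q, of_nat a, of_nat c, of_nat p, s, of_nat b]))) {(l, m, n). m > 0 \<and> -(l + m) > 0 \<and> l + m + n > 0}"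
  proof -
    let ?z = "vector [of_nat q, of_nat a, of_nat c, of_nat p, s, of_nat b] :: complex ^ 6"
    show ?thesis
    proof (rule chamber_has_sum[where i = "\<lambda>(x, y, t). (-x - y, x, y + t)"])
      show "(A3_term ?z has_sum F ?z) ({1..} \<times> {1..} \<times> {1..})"
        by (rule assms[of "p + a"]) (simp add: S_terms_def Let_def)
      fix l m n :: int
      assume *: "m > 0" "-(l + m) > 0" "l + m + n > 0"
      have sum: "nat m + nat (-(l + m)) = nat (-l)" "nat (-(l + m)) + nat (l + m + n) = nat n" "nat (-l) + nat (l + m + n) = nat (m + n)"
        using * by simp_all
      have pos: "-l > 0" "n > 0" "m + n > 0" using * by simp_all
      show "root_term p q s a b c (l, m, n) = (-1) ^ (p + a) * A3_term ?z (nat m, nat (-(l + m)), nat (l + m + n))"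
        by (simp only: root_term_simps sum
           inverse_int_power_pos[OF *(1)] inverse_int_power_neg[OF *(2)] inverse_int_power_pos[OF *(3)] inverse_int_power_neg[OF pos(1)] inverse_int_powr_pos[OF pos(2)] inverse_int_power_pos[OF pos(3)] mult_ac)
    qed auto
  qed
  have 4: "(root_term p q s a b c has_sum ((-1) ^ (p + a + c) * F (vector [of_nat q, s, of_nat c, of_nat b, of_nat a, of_nat p]))) {(l, m, n). m > 0 \<and> n > 0 \<and> -(l + m + n) > 0}"
  proof -
    let ?z = "vector [of_nat q, s, of_nat c, of_nat b, of_nat a, of_nat p] :: complex ^ 6"
    show ?thesis
    proof (rule chamber_has_sum[where i = "\<lambda>(x, y, t). (-x - y - t, x, y)"])
      show "(A3_term ?z has_sum F ?z) ({1..} \<times> {1..} \<times> {1..})"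
        by (rule assms[of "p + a + c"]) (simp add: S_terms_def Let_def)
      fix l m n :: int
      assume *: "m > 0" "n > 0" "-(l + m + n) > 0"
      have sum: "nat m + nat n = nat (m + n)" "nat n + nat (-(l + m + n)) = nat (-(l + m))" "nat (m + n) + nat (-(l + m + n)) = nat (-l)"
        using * by simp_all
      have pos: "m + n > 0" "-(l + m) > 0" "-l > 0" using * by simp_all
      show "root_term p q s a b c (l, m, n) = (-1) ^ (p + a + c) * A3_term ?z (nat m, nat n, nat (-(l + m + n)))"
        by (simp only: root_term_simps sum
           inverse_int_power_pos[OF *(1)] inverse_int_powr_pos[OF *(2)] inverse_int_power_neg[OF *(3)] inverse_int_power_pos[OF pos(1)] inverse_int_power_neg[OF pos(2)] inverse_int_power_neg[OF pos(3)] mult_ac)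
    qed auto
  qed
  have 5: "(root_term p q s a b c has_sum ((-1) ^ q * F (vector [of_nat a, of_nat q, of_nat b, of_nat p, s, of_nat c]))) {(l, m, n). l + m > 0 \<and> -m > 0 \<and> m + n > 0}"
  proof -
    let ?z = "vector [of_nat a, of_nat q, of_nat b, of_nat p, s, of_nat c] :: complex ^ 6"
    show ?thesis
    proof (rule chamber_has_sum[where i = "\<lambda>(x, y, t). (x + y, -y, y + t)"])
      show "(A3_term ?z has_sum F ?z) ({1..} \<times> {1..} \<times> {1..})"
        by (rule assms[of "q"]) (simp add: S_terms_def Let_def)
      fix l m n :: int
      assume *: "l + m > 0" "-m > 0" "m + n > 0"
      have sum: "nat (l + m) + nat (-m) = nat l" "nat (-m) + nat (m + n) = nat n" "nat l + nat (m + n) = nat (l + m + n)"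
        using * by simp_all
      have pos: "l > 0" "n > 0" "l + m + n > 0" using * by simp_all
      show "root_term p q s a b c (l, m, n) = (-1) ^ q * A3_term ?z (nat (l + m), nat (-m), nat (m + n))"
        by (simp only: root_term_simps sum
           inverse_int_power_pos[OF *(1)] inverse_int_power_neg[OF *(2)] inverse_int_power_pos[OF *(3)] inverse_int_power_pos[OF pos(1)] inverse_int_powr_pos[OF pos(2)] inverse_int_power_pos[OF pos(3)] mult_ac)
    qed auto
  qed
  have 6: "(root_term p q s a b c has_sum ((-1) ^ (q + b) * F (vector [of_nat a, s, of_nat b, of_nat c, of_nat q, of_nat p]))) {(l, m, n). l + m > 0 \<and> n > 0 \<and> -(m + n) > 0}"
  proof -
    let ?z = "vector [of_nat a, s, of_nat b, of_nat c, of_nat q, of_nat p] :: complex ^ 6"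
    show ?thesis
    proof (rule chamber_has_sum[where i = "\<lambda>(x, y, t). (x + y + t, -y - t, y)"])
      show "(A3_term ?z has_sum F ?z) ({1..} \<times> {1..} \<times> {1..})"
        by (rule assms[of "q + b"]) (simp add: S_terms_def Let_def)
      fix l m n :: int
      assume *: "l + m > 0" "n > 0" "-(m + n) > 0"
      have sum: "nat (l + m) + nat n = nat (l + m + n)" "nat n + nat (-(m + n)) = nat (-m)" "nat (l + m + n) + nat (-(m + n)) = nat l"
        using * by simp_all
      have pos: "l + m + n > 0" "-m > 0" "l > 0" using * by simp_all
      show "root_term p q s a b c (l, m, n) = (-1) ^ (q + b) * A3_term ?z (nat (l + m), nat n, nat (-(m + n)))"
        by (simp only: root_term_simps sum
           inverse_int_power_pos[OF *(1)] inverse_int_powr_pos[OF *(2)] inverse_int_power_neg[OF *(3)] inverse_int_power_pos[OF pos(1)] inverse_int_power_neg[OF pos(2)] inverse_int_power_pos[OF pos(3)] mult_ac)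
    qed auto
  qed
  have 7: "(root_term p q s a b c has_sum ((-1) ^ (q + a) * F (vector [of_nat a, of_nat p, of_nat b, of_nat q, of_nat c, s]))) {(l, m, n). -(l + m) > 0 \<and> l > 0 \<and> m + n > 0}"
  proof -
    let ?z = "vector [of_nat a, of_nat p, of_nat b, of_nat q, of_nat c, s] :: complex ^ 6"
    show ?thesis
    proof (rule chamber_has_sum[where i = "\<lambda>(x, y, t). (y, -x - y, x + y + t)"])
      show "(A3_term ?z has_sum F ?z) ({1..} \<times> {1..} \<times> {1..})"
        by (rule assms[of "q + a"]) (simp add: S_terms_def Let_def)
      fix l m n :: int
      assume *: "-(l + m) > 0" "l > 0" "m + n > 0"
      have sum: "nat (-(l + m)) + nat l = nat (-m)" "nat l + nat (m + n) = nat (l + m + n)" "nat (-m) + nat (m + n) = nat n"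
        using * by simp_all
      have pos: "-m > 0" "l + m + n > 0" "n > 0" using * by simp_all
      show "root_term p q s a b c (l, m, n) = (-1) ^ (q + a) * A3_term ?z (nat (-(l + m)), nat l, nat (m + n))"
        by (simp only: root_term_simps sum
           inverse_int_power_neg[OF *(1)] inverse_int_power_pos[OF *(2)] inverse_int_power_pos[OF *(3)] inverse_int_power_neg[OF pos(1)] inverse_int_power_pos[OF pos(2)] inverse_int_powr_pos[OF pos(3)] mult_ac)
    qed auto
  qed
  have 8: "(root_term p q s a b c has_sum ((-1) ^ (q + a + b) * F (vector [of_nat a, of_nat c, of_nat b, s, of_nat p, of_nat q]))) {(l, m, n). -(l + m) > 0 \<and> l + m + n > 0 \<and> -(m + n) > 0}"
  proof -
    let ?z = "vector [of_nat a, of_nat c, of_nat b, s, of_nat p, of_nat q] :: complex ^ 6"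
    show ?thesis
    proof (rule chamber_has_sum[where i = "\<lambda>(x, y, t). (y + t, -x - y - t, x + y)"])
      show "(A3_term ?z has_sum F ?z) ({1..} \<times> {1..} \<times> {1..})"
        by (rule assms[of "q + a + b"]) (simp add: S_terms_def Let_def)
      fix l m n :: int
      assume *: "-(l + m) > 0" "l + m + n > 0" "-(m + n) > 0"
      have sum: "nat (-(l + m)) + nat (l + m + n) = nat n" "nat (l + m + n) + nat (-(m + n)) = nat l" "nat n + nat (-(m + n)) = nat (-m)"
        using * by simp_all
      have pos: "n > 0" "l > 0" "-m > 0" using * by simp_all
      show "root_term p q s a b c (l, m, n) = (-1) ^ (q + a + b) * A3_term ?z (nat (-(l + m)), nat (l + m + n), nat (-(m + n)))"
        by (simp only: root_term_simps sum
           inverse_int_power_neg[OF *(1)] inverse_int_power_pos[OF *(2)] inverse_int_power_neg[OF *(3)] inverse_int_powr_pos[OF pos(1)] inverse_int_power_pos[OF pos(2)] inverse_int_power_neg[OF pos(3)] mult_ac)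
    qed auto
  qed
  have 9: "(root_term p q s a b c has_sum ((-1) ^ (q + a + b + c) * F (vector [s, of_nat c, of_nat p, of_nat a, of_nat b, of_nat q]))) {(l, m, n). n > 0 \<and> -(l + m + n) > 0 \<and> l > 0}"
  proof -
    let ?z = "vector [s, of_nat c, of_nat p, of_nat a, of_nat b, of_nat q] :: complex ^ 6"
    show ?thesis
    proof (rule chamber_has_sum[where i = "\<lambda>(x, y, t). (t, -x - y - t, x)"])
      show "(A3_term ?z has_sum F ?z) ({1..} \<times> {1..} \<times> {1..})"
        by (rule assms[of "q + a + b + c"]) (simp add: S_terms_def Let_def)
      fix l m n :: int
      assume *: "n > 0" "-(l + m + n) > 0" "l > 0"
      have sum: "nat n + nat (-(l + m + n)) = nat (-(l + m))" "nat (-(l + m + n)) + nat l = nat (-(m + n))" "nat (-(l + m)) + nat l = nat (-m)"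
        using * by simp_all
      have pos: "-(l + m) > 0" "-(m + n) > 0" "-m > 0" using * by simp_all
      show "root_term p q s a b c (l, m, n) = (-1) ^ (q + a + b + c) * A3_term ?z (nat n, nat (-(l + m + n)), nat l)"
        by (simp only: root_term_simps sum
           inverse_int_powr_pos[OF *(1)] inverse_int_power_neg[OF *(2)] inverse_int_power_pos[OF *(3)] inverse_int_power_neg[OF pos(1)] inverse_int_power_neg[OF pos(2)] inverse_int_power_neg[OF pos(3)] mult_ac)
    qed auto
  qed
  have 10: "(root_term p q s a b c has_sum ((-1) ^ (p + q + a) * F (vector [of_nat q, of_nat p, of_nat c, of_nat a, of_nat b, s]))) {(l, m, n). -m > 0 \<and> -l > 0 \<and> l + m + n > 0}"
  proof -
    let ?z = "vector [of_nat q, of_nat p, of_nat c, of_nat a, of_nat b, s] :: complex ^ 6"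
    show ?thesis
    proof (rule chamber_has_sum[where i = "\<lambda>(x, y, t). (-y, -x, x + y + t)"])
      show "(A3_term ?z has_sum F ?z) ({1..} \<times> {1..} \<times> {1..})"
        by (rule assms[of "p + q + a"]) (simp add: S_terms_def Let_def)
      fix l m n :: int
      assume *: "-m > 0" "-l > 0" "l + m + n > 0"
      have sum: "nat (-m) + nat (-l) = nat (-(l + m))" "nat (-l) + nat (l + m + n) = nat (m + n)" "nat (-(l + m)) + nat (l + m + n) = nat n"
        using * by simp_all
      have pos: "-(l + m) > 0" "m + n > 0" "n > 0" using * by simp_all
      show "root_term p q s a b c (l, m, n) = (-1) ^ (p + q + a) * A3_term ?z (nat (-m), nat (-l), nat (l + m + n))"
        by (simp only: root_term_simps sum
           inverse_int_power_neg[OF *(1)] inverse_int_power_neg[OF *(2)] inverse_int_power_pos[OF *(3)] inverse_int_power_neg[OF pos(1)] inverse_int_power_pos[OF pos(2)] inverse_int_powr_pos[OF pos(3)] mult_ac)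
    qed auto
  qed
  have 11: "(root_term p q s a b c has_sum ((-1) ^ (p + q + a + c) * F (vector [of_nat q, of_nat b, of_nat c, s, of_nat p, of_nat a]))) {(l, m, n). -m > 0 \<and> m + n > 0 \<and> -(l + m + n) > 0}"
  proof -
    let ?z = "vector [of_nat q, of_nat b, of_nat c, s, of_nat p, of_nat a] :: complex ^ 6"
    show ?thesis
    proof (rule chamber_has_sum[where i = "\<lambda>(x, y, t). (-y - t, -x, x + y)"])
      show "(A3_term ?z has_sum F ?z) ({1..} \<times> {1..} \<times> {1..})"
        by (rule assms[of "p + q + a + c"]) (simp add: S_terms_def Let_def)
      fix l m n :: int
      assume *: "-m > 0" "m + n > 0" "-(l + m + n) > 0"
      have sum: "nat (-m) + nat (m + n) = nat n" "nat (m + n) + nat (-(l + m + n)) = nat (-l)" "nat n + nat (-(l + m + n)) = nat (-(l + m))"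
        using * by simp_all
      have pos: "n > 0" "-l > 0" "-(l + m) > 0" using * by simp_all
      show "root_term p q s a b c (l, m, n) = (-1) ^ (p + q + a + c) * A3_term ?z (nat (-m), nat (m + n), nat (-(l + m + n)))"
        by (simp only: root_term_simps sum
           inverse_int_power_neg[OF *(1)] inverse_int_power_pos[OF *(2)] inverse_int_power_neg[OF *(3)] inverse_int_powr_pos[OF pos(1)] inverse_int_power_neg[OF pos(2)] inverse_int_power_neg[OF pos(3)] mult_ac)
    qed auto
  qed
  have 12: "(root_term p q s a b c has_sum ((-1) ^ (p + q + a + b + c) * F (vector [s, of_nat b, of_nat p, of_nat q, of_nat c, of_nat a]))) {(l, m, n). n > 0 \<and> -(m + n) > 0 \<and> -l > 0}"
  proof -
    let ?z = "vector [s, of_nat b, of_nat p, of_nat q, of_nat c, of_nat a] :: complex ^ 6"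
    show ?thesis
    proof (rule chamber_has_sum[where i = "\<lambda>(x, y, t). (-t, -x - y, x)"])
      show "(A3_term ?z has_sum F ?z) ({1..} \<times> {1..} \<times> {1..})"
        by (rule assms[of "p + q + a + b + c"]) (simp add: S_terms_def Let_def)
      fix l m n :: int
      assume *: "n > 0" "-(m + n) > 0" "-l > 0"
      have sum: "nat n + nat (-(m + n)) = nat (-m)" "nat (-(m + n)) + nat (-l) = nat (-(l + m + n))" "nat (-m) + nat (-l) = nat (-(l + m))"
        using * by simp_all
      have pos: "-m > 0" "-(l + m + n) > 0" "-(l + m) > 0" using * by simp_all
      show "root_term p q s a b c (l, m, n) = (-1) ^ (p + q + a + b + c) * A3_term ?z (nat n, nat (-(m + n)), nat (-l))"
        by (simp only: root_term_simps sum
           inverse_int_powr_pos[OF *(1)] inverse_int_power_neg[OF *(2)] inverse_int_power_neg[OF *(3)] inverse_int_power_neg[OF pos(1)] inverse_int_power_neg[OF pos(2)] inverse_int_power_neg[OF pos(3)] mult_ac)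
    qed auto
  qed
  note u2 = has_sum_disj[OF 1 2]
  note u3 = has_sum_disj[OF u2 3]
  note u4 = has_sum_disj[OF u3 4]
  note u5 = has_sum_disj[OF u4 5]
  note u6 = has_sum_disj[OF u5 6]
  note u7 = has_sum_disj[OF u6 7]
  note u8 = has_sum_disj[OF u7 8]
  note u9 = has_sum_disj[OF u8 9]
  note u10 = has_sum_disj[OF u9 10]
  note u11 = has_sum_disj[OF u10 11]
  note u12 = has_sum_disj[OF u11 12]
  have "(root_term p q s a b c has_sum S_sum F p q a b c s) {(l, m, n). (((((((((((l > 0 \<and> m > 0 \<and> n > 0) \<or> (-l > 0 \<and> l + m > 0 \<and> n > 0)) \<or> (m > 0 \<and> -(l + m) > 0 \<and> l + m + n > 0)) \<or> (m > 0 \<and> n > 0 \<and> -(l + m + n) > 0)) \<or> (l + m > 0 \<and> -m > 0 \<and> m + n > 0)) \<or> (l + m > 0 \<and> n > 0 \<and> -(m + n) > 0)) \<or> (-(l + m) > 0 \<and> l > 0 \<and> m + n > 0)) \<or> (-(l + m) > 0 \<and> l + m + n > 0 \<and> -(m + n) > 0)) \<or> (n > 0 \<and> -(l + m + n) > 0 \<and> l > 0)) \<or> (-m > 0 \<and> -l > 0 \<and> l + m + n > 0)) \<or> (-m > 0 \<and> m + n > 0 \<and> -(l + m + n) > 0)) \<or> (n > 0 \<and> -(m + n) > 0 \<and> -l > 0)}"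
    by (rule has_sum_transform[OF u12]) (linarith | simp add: S_sum_def S_terms_def Let_def)+
  thus ?thesis by (simp only: regular_points_chambers disj_assoc)
qed

section \<open>Convergence\<close>

lemma summable_on_mult_Times:
  fixes f :: "'i \<Rightarrow> real" and g :: "'j \<Rightarrow> real"
  assumes "f summable_on A" "g summable_on B" "\<And>x. x \<in> A \<Longrightarrow> f x \<ge> 0" "\<And>y. y \<in> B \<Longrightarrow> g y \<ge> 0"
  shows "(\<lambda>(x, y). f x * g y) summable_on (A \<times> B)"
proof (rule summable_on_SigmaI)
  show "((\<lambda>y. case (x, y) of (x, y) \<Rightarrow> f x * g y) has_sum (f x * infsum g B)) B" for x
    using has_sum_cmult_right[OF has_sum_infsum[OF assms(2)], of "f x"] by simp
  show "(\<lambda>x. f x * infsum g B) summable_on A" by (rule summable_on_cmult_left[OF assms(1)])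
qed (use assms in auto)

lemma nat_powr_summable_on:
  assumes "\<sigma> > 1"
  shows "(\<lambda>n. real n powr - \<sigma>) summable_on {1..}"
proof -
  have "summable (\<lambda>n. real n powr - \<sigma>)" using assms by (subst summable_real_powr_iff) simp
  hence "(\<lambda>n. real n powr - \<sigma>) summable_on UNIV"
    by (intro norm_summable_imp_summable_on) simp
  thus ?thesis by (rule summable_on_subset_banach) auto
qed

lemma norm_nat_powr: "n \<ge> 1 \<Longrightarrow> norm (of_nat n powr s :: complex) = real n powr Re s"
  by (subst norm_powr_real_powr) auto

definition A3_bound :: "nat \<times> nat \<times> nat \<Rightarrow> real" where
  "A3_bound = (\<lambda>(l, m, n). real l powr (- (3/2)) * (real m powr (- (3/2)) * real n powr (- (3/2))))"

lemma A3_bound_summable: "A3_bound summable_on ({1..} \<times> {1..} \<times> {1..})"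
proof -
  have 1: "(\<lambda>n. real n powr - (3/2)) summable_on {1..}" by (rule nat_powr_summable_on) simp
  have "(\<lambda>(m, n). real m powr (- (3/2)) * real n powr (- (3/2))) summable_on ({1..} \<times> {1..})"
    by (rule summable_on_mult_Times[OF 1 1]) auto
  from summable_on_mult_Times[OF 1 this] show ?thesis
    by (simp add: A3_bound_def case_prod_unfold)
qed

text \<open>Pair \<open>l\<close> with \<open>l + m\<close>, \<open>m\<close> with
  \<open>m + n\<close> and \<open>n\<close> with \<open>l + m + n\<close>: each pair yields the
  exponent 3/4 + 3/4 = 3/2 > 1. The threshold lies below 1 so that points with real parts equal to 1
  are interior.\<close>

lemma norm_A3_term_le:
  assumes z: "\<And>i. Re (vec_nth z i) \<ge> 3/4" and x: "x \<in> {1..} \<times> {1..} \<times> {1..}"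
  shows "norm (A3_term z x) \<le> A3_bound x"
proof -
  obtain l m n where [simp]: "x = (l, m, n)" and lmn: "l \<ge> 1" "m \<ge> 1" "n \<ge> 1" using x by auto
  have ge: "real k powr (3/4) \<le> norm (of_nat j powr (vec_nth z i) :: complex)" if "k \<ge> 1" "k \<le> j" for i k j
  proof -
    have "real k powr (3/4) \<le> real j powr (3/4)" using that by (intro powr_mono2) auto
    also have "\<dots> \<le> real j powr Re (vec_nth z i)" using that z by (intro powr_mono) auto
    finally show ?thesis using that by (simp add: norm_nat_powr)
  qed
  have sq: "real k powr (3/4) * real k powr (3/4) = real k powr (3/2)" for k by (simp flip: powr_add)
  have "real l powr (3/4) * real m powr (3/4) * real n powr (3/4) * real l powr (3/4) * real m powr (3/4) * real n powr (3/4)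
    \<le> norm (of_nat l powr (vec_nth z 1) :: complex) * norm (of_nat m powr (vec_nth z 2) :: complex) *
       norm (of_nat n powr (vec_nth z 3) :: complex) * norm (of_nat (l + m) powr (vec_nth z 4) :: complex) *
       norm (of_nat (m + n) powr (vec_nth z 5) :: complex) * norm (of_nat (l + m + n) powr (vec_nth z 6) :: complex)"
    by (intro mult_mono ge mult_nonneg_nonneg) (use lmn in auto)
  hence "real l powr (3/2) * (real m powr (3/2) * real n powr (3/2)) \<le> norm (of_nat l powr (vec_nth z 1) *
       of_nat m powr (vec_nth z 2) * of_nat n powr (vec_nth z 3) * of_nat (l + m) powr (vec_nth z 4) *
       of_nat (m + n) powr (vec_nth z 5) * of_nat (l + m + n) powr (vec_nth z 6) :: complex)"
    unfolding norm_mult sq[symmetric] by (simp only: mult_ac)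
  moreover have "real l powr (3/2) * (real m powr (3/2) * real n powr (3/2)) > 0" using lmn by simp
  ultimately have "1 / norm (of_nat l powr (vec_nth z 1) *
       of_nat m powr (vec_nth z 2) * of_nat n powr (vec_nth z 3) * of_nat (l + m) powr (vec_nth z 4) *
       of_nat (m + n) powr (vec_nth z 5) * of_nat (l + m + n) powr (vec_nth z 6) :: complex)
     \<le> 1 / (real l powr (3/2) * (real m powr (3/2) * real n powr (3/2)))"
    using le_imp_inverse_le by (simp only: inverse_eq_divide[symmetric])
  thus ?thesis by (simp add: A3_term_def A3_bound_def norm_divide powr_minus_divide)
qed

lemma A3_term_abs_summable:
  assumes "\<And>i. Re (vec_nth z i) \<ge> 3/4"
  shows "(\<lambda>x. norm (A3_term z x)) summable_on ({1..} \<times> {1..} \<times> {1..})"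
  using A3_bound_summable norm_A3_term_le[OF assms] by (rule Infinite_Sum.abs_summable_on_comparison_test')

text \<open>The majorant \<open>A3_bound\<close> does not depend on \<open>z\<close>, so the M-test
  gives a uniform limit of continuous functions. Continuity is all that the restriction to lines
  asks for.\<close>

lemma isCont_A3_sum:
  assumes z: "\<And>i. Re (vec_nth z i) > 3/4"
  shows "isCont (\<lambda>z. \<Sum>\<^sub>\<infinity>x\<in>{1..} \<times> {1..} \<times> {1..}. A3_term z x) z"
proof -
  let ?N = "{1..} \<times> {1..} \<times> {1..} :: (nat \<times> nat \<times> nat) set"
  let ?U = "{z :: complex ^ 6. \<forall>i. Re (vec_nth z i) > 3/4}"
  have U: "open ?U"
  proof -
    have "?U = (\<Inter>i. {z. Re (vec_nth z i) > 3/4})" by auto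
    moreover have "open {z :: complex ^ 6. Re (vec_nth z i) > 3/4}" for i
      by (intro open_Collect_less continuous_intros)
    ultimately show ?thesis using open_INT[of UNIV "\<lambda>i. {z :: complex ^ 6. Re (vec_nth z i) > 3/4}"] by simp
  qed
  have "uniform_limit ?U (\<lambda>X z. \<Sum>x\<in>X. A3_term z x) (\<lambda>z. \<Sum>\<^sub>\<infinity>x\<in>?N. A3_term z x) (finite_subsets_at_top ?N)"
    by (rule Weierstrass_m_test_general[OF norm_A3_term_le A3_bound_summable]) (auto intro: less_imp_le)
  moreover have "eventually (\<lambda>X. continuous_on ?U (\<lambda>z. \<Sum>x\<in>X. A3_term z x)) (finite_subsets_at_top ?N)"
  proof -
    have "continuous_on ?U (\<lambda>z. A3_term z x)" if "x \<in> ?N" for x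
      using that by (auto simp: A3_term_def intro!: continuous_intros simp del: of_nat_add)
    thus ?thesis by (auto intro!: eventually_finite_subsets_at_top_weakI continuous_on_sum)
  qed
  ultimately have "continuous_on ?U (\<lambda>z. \<Sum>\<^sub>\<infinity>x\<in>?N. A3_term z x)"
    by (intro uniform_limit_theorem[rotated]) auto
  thus ?thesis using U z by (simp add: continuous_on_eq_continuous_at)
qed

lemma int_square_summable_on: "(\<lambda>l. 1 / real_of_int l ^ 2) summable_on - {0}"
proof -
  have "(\<lambda>l. 1 / complex_of_int l ^ 2) summable_on - {0}"
    using has_sum_zeta_int[of 2] by (auto simp: summable_on_def)
  hence "(\<lambda>l. norm (1 / complex_of_int l ^ 2)) summable_on - {0}"
    by (simp add: summable_on_iff_abs_summable_on_complex)
  thus ?thesis by (simp add: norm_divide norm_power)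
qed

text \<open>The pairs \<open>(l, m)\<close> of \<open>T_sum\<close> under the names
  \<open>(m, n)\<close> and with \<open>n\<close> an integer: the base over which
  \<open>regular_points\<close> is fibred by \<open>l\<close>.\<close>

definition T_index :: "(int \<times> int) set" where
  "T_index = {(m, n). m \<noteq> 0 \<and> n > 0 \<and> m + n \<noteq> 0}"

definition T_term :: "nat \<Rightarrow> complex \<Rightarrow> nat \<Rightarrow> int \<times> int \<Rightarrow> complex" where
  "T_term p s q = (\<lambda>(m, n). 1 / (of_int m ^ p * of_int n powr s * of_int (m + n) ^ q))"

lemma T_term_bound_summable:
  assumes "\<sigma> > 1"
  shows "(\<lambda>(m, n). real_of_int n powr (- \<sigma>) * (1 / real_of_int m ^ 2 + 1 / real_of_int (m + n) ^ 2)) summable_on T_index"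
proof -
  have 1: "(\<lambda>n. real_of_int n powr - \<sigma>) summable_on {1..}"
  proof -
    have "(\<lambda>n. real_of_int n powr - \<sigma>) summable_on {1..} \<longleftrightarrow> (\<lambda>n. real n powr - \<sigma>) summable_on {1..}"
      by (rule summable_on_reindex_bij_witness[of _ int nat]) auto
    thus ?thesis using nat_powr_summable_on[OF assms] by simp
  qed
  have 2: "(\<lambda>(n, m). real_of_int n powr (- \<sigma>) * (1 / real_of_int m ^ 2)) summable_on ({1..} \<times> (- {0}))"
    by (rule summable_on_mult_Times[OF 1 int_square_summable_on]) auto
  have "(\<lambda>(m, n). real_of_int n powr (- \<sigma>) * (1 / real_of_int m ^ 2)) summable_on ((- {0}) \<times> {1..})"
    using 2 by (subst summable_on_reindex_bij_witness[where i = prod.swap and j = prod.swap and T = "{1..} \<times> (- {0})"]) auto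
  hence a: "(\<lambda>(m, n). real_of_int n powr (- \<sigma>) * (1 / real_of_int m ^ 2)) summable_on T_index"
    by (rule summable_on_subset_banach) (auto simp: T_index_def)
  \<comment> \<open>The substitution \<open>k = m + n\<close> decouples the second square from
    \<open>n\<close>.\<close>
  have "(\<lambda>(m, n). real_of_int n powr (- \<sigma>) * (1 / real_of_int (m + n) ^ 2)) summable_on {(m, n). n > 0 \<and> m + n \<noteq> 0}"
    using 2 by (subst summable_on_reindex_bij_witness[where i = "\<lambda>(n, k). (k - n, n)" and j = "\<lambda>(m, n). (n, m + n)" and T = "{1..} \<times> (- {0})"]) auto
  hence b: "(\<lambda>(m, n). real_of_int n powr (- \<sigma>) * (1 / real_of_int (m + n) ^ 2)) summable_on T_index"
    by (rule summable_on_subset_banach) (auto simp: T_index_def)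
  from summable_on_add[OF a b] show ?thesis by (simp add: case_prod_unfold distrib_left)
qed

text \<open>Exponents above 1 only help, since the integers are nonzero. For
  \<open>p = q = 1\<close> the inequality between products and squares separates \<open>m\<close>
  from \<open>m + n\<close>, leaving sums that converge as soon as \<open>Re s > 1\<close>.\<close>

lemma norm_T_term_le:
  assumes "p \<ge> 1" "q \<ge> 1" "x \<in> T_index"
  shows "norm (T_term p s q x) \<le> (case x of (m, n) \<Rightarrow> real_of_int n powr (- Re s) * (1 / real_of_int m ^ 2 + 1 / real_of_int (m + n) ^ 2))"
proof -
  obtain m n where x: "x = (m, n)" and mn: "m \<noteq> 0" "n > 0" "m + n \<noteq> 0" using assms by (auto simp: T_index_def)
  have pow: "\<bar>real_of_int i\<bar> \<le> \<bar>real_of_int i\<bar> ^ e" if "i \<noteq> 0" "e \<ge> 1" for i e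
  proof -
    have "\<bar>real_of_int i\<bar> \<ge> 1" using that by linarith
    thus ?thesis using power_increasing[of 1 e "\<bar>real_of_int i\<bar>"] that by simp
  qed
  have amgm: "1 / (u * v) \<le> 1 / u ^ 2 + 1 / v ^ 2" if "u > 0" "v > 0" for u v :: real
  proof -
    have "2 * (1 / u) * (1 / v) \<le> (1 / u) ^ 2 + (1 / v) ^ 2" by (rule sum_squares_bound)
    moreover have "(1 / u) * (1 / v) \<ge> 0" using that by simp
    ultimately have "(1 / u) * (1 / v) \<le> (1 / u) ^ 2 + (1 / v) ^ 2" by linarith
    thus ?thesis by (simp add: power_one_over)
  qed
  have nn: "norm (of_int n powr s :: complex) = real_of_int n powr Re s"
    using mn by (subst norm_powr_real_powr) auto
  have "norm (T_term p s q x) = real_of_int n powr (- Re s) * (1 / (\<bar>real_of_int m\<bar> ^ p * \<bar>real_of_int (m + n)\<bar> ^ q))"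
    unfolding x T_term_def
    by (simp only: prod.case norm_divide norm_mult norm_power nn norm_of_int norm_one powr_minus_divide) simp
  also have "\<dots> \<le> real_of_int n powr (- Re s) * (1 / (\<bar>real_of_int m\<bar> * \<bar>real_of_int (m + n)\<bar>))"
    using mn pow[of m p] pow[of "m + n" q] assms
    by (intro mult_left_mono divide_left_mono mult_mono mult_pos_pos zero_less_power) (auto simp del: of_int_add)
  also have "\<dots> \<le> real_of_int n powr (- Re s) * (1 / \<bar>real_of_int m\<bar> ^ 2 + 1 / \<bar>real_of_int (m + n)\<bar> ^ 2)"
    using mn by (intro mult_left_mono amgm) (auto simp del: of_int_add)
  finally show ?thesis by (simp add: x del: of_int_add)
qed

lemma has_sum_T_sum:
  assumes "p \<ge> 1" "q \<ge> 1" "Re s > 1"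
  shows "(T_term p s q has_sum T_sum p s q 1 1) T_index"
proof -
  have "(\<lambda>x. norm (T_term p s q x)) summable_on T_index"
    using T_term_bound_summable[OF assms(3)] norm_T_term_le[OF assms(1,2)] by (rule Infinite_Sum.abs_summable_on_comparison_test')
  hence "T_term p s q summable_on T_index" by (rule abs_summable_summable)
  moreover have "infsum (T_term p s q) T_index = T_sum p s q 1 1"
    unfolding T_sum_def
    by (rule infsum_reindex_bij_witness[of _ "\<lambda>(l, m). (l, int m)" "\<lambda>(l, n). (l, nat n)"])
       (auto simp: T_index_def T_term_def of_nat_nat)
  ultimately show ?thesis using has_sum_infsum by metis
qed

section \<open>The parity identity\<close>

text \<open>The parameter \<open>\<tau>\<close> lets one formula be used three times: for single
  terms \<open>T_term\<close>, for the series \<open>T_sum\<close>, and for the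
  continuation.\<close>

definition parity_rhs ::
  "(nat \<Rightarrow> complex \<Rightarrow> nat \<Rightarrow> complex) \<Rightarrow> nat \<Rightarrow> nat \<Rightarrow> nat \<Rightarrow> nat \<Rightarrow> nat \<Rightarrow> complex \<Rightarrow> complex" where
  "parity_rhs \<tau> p q a b c s =
      2 * (-1) ^ p * (\<Sum>j=0..p div 2. riemann_zeta (of_nat (2 * j)) *
        (\<Sum>\<omega>=0..p - 2 * j.
           of_nat ((\<omega> + a - 1) choose \<omega>) *
           of_nat ((p + c - 2 * j - \<omega> - 1) choose (c - 1)) *
           \<tau> (q + a + \<omega>) s (p + b + c - 2 * j - \<omega>)))
    + 2 * (-1) ^ (p + a) * (\<Sum>j=0..c div 2. riemann_zeta (of_nat (2 * j)) *
        (\<Sum>\<omega>=0..c - 2 * j.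
           of_nat ((\<omega> + a - 1) choose \<omega>) *
           of_nat ((p + c - 2 * j - \<omega> - 1) choose (p - 1)) *
           \<tau> q (s + of_nat (a + \<omega>)) (p + b + c - 2 * j - \<omega>)))
    + 2 * (-1) ^ p * (\<Sum>j=0..a div 2. riemann_zeta (of_nat (2 * j)) *
        (\<Sum>\<omega>=0..p - 1.
           of_nat ((\<omega> + a - 2 * j) choose \<omega>) *
           of_nat ((p + c - 2 - \<omega>) choose (c - 1)) *
           \<tau> (q + a - 2 * j + \<omega> + 1) s (p + b + c - 1 - \<omega>)))
    + 2 * (-1) ^ (p + a) * (\<Sum>j=0..a div 2. riemann_zeta (of_nat (2 * j)) *
        (\<Sum>\<omega>=0..c - 1.
           of_nat ((\<omega> + a - 2 * j) choose \<omega>) *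
           of_nat ((p + c - 2 - \<omega>) choose (p - 1)) *
           \<tau> q (s + of_nat (a - 2 * j + \<omega> + 1)) (p + b + c - \<omega> - 1)))"

lemma has_sum_finite_sum:
  fixes f :: "'k \<Rightarrow> 'i \<Rightarrow> complex"
  assumes "finite K" "\<And>k. k \<in> K \<Longrightarrow> (f k has_sum S k) A"
  shows "((\<lambda>x. \<Sum>k\<in>K. f k x) has_sum (\<Sum>k\<in>K. S k)) A"
  using assms by (induction K rule: finite_induct) (auto intro: has_sum_add)

lemma has_sum_parity_rhs:
  assumes "p \<ge> 1" "q \<ge> 1" "a \<ge> 1" "b \<ge> 1" "c \<ge> 1" "Re s > 1"
  shows "((\<lambda>x. parity_rhs (\<lambda>p s q. T_term p s q x) p q a b c s) has_sum
           parity_rhs (\<lambda>p s q. T_sum p s q 1 1) p q a b c s) T_index"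
  unfolding parity_rhs_def
  by (intro has_sum_add has_sum_cmult_right has_sum_finite_sum has_sum_T_sum finite_atLeastAtMost)
     (use assms in \<open>auto intro: add_pos_nonneg\<close>)

text \<open>The factors without \<open>l\<close> are absorbed into the expansion: powers of
  \<open>m\<close> raise the first index by at least \<open>q\<close>, powers of \<open>n\<close>
  shift \<open>s\<close>, and powers of \<open>m + n\<close> are increased by
  \<open>b\<close>.\<close>

lemma weighted_pole_sum:
  assumes pqabc: "p \<ge> 1" "q \<ge> 1" "a \<ge> 1" "b \<ge> 1" "c \<ge> 1" and mn: "(m, n) \<in> T_index"
  shows "1 / (of_int m ^ q * of_int n powr s * of_int (m + n) ^ b) *
      pole_sum (of_int (m + n)) (triple_coeff (of_int m) a) (triple_coeff' (of_int n) a) p c =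
    parity_rhs (\<lambda>p s q. T_term p s q (m, n)) p q a b c s"
proof -
  define \<kappa> where "\<kappa> = 1 / (complex_of_int m ^ q * of_int n powr s * of_int (m + n) ^ b)"
  have n: "n > 0" using mn by (simp add: T_index_def)
  have k1: "\<kappa> * (1 / (of_int m ^ k * of_int (m + n) ^ e)) = T_term i s r (m, n)"
    if "i = q + k" "r = b + e" for k e i r
    unfolding \<kappa>_def T_term_def that by (simp add: power_add mult_ac del: of_int_add)
  have k2: "\<kappa> * (1 / (of_int n ^ k * of_int (m + n) ^ e)) = T_term q (s + of_nat k) r (m, n)"
    if "r = b + e" for k e r
  proof -
    have "complex_of_int n powr (s + of_nat k) = of_int n powr s * of_int n ^ k"
      using n by (subst powr_add) (simp add: powr_nat')
    thus ?thesis unfolding \<kappa>_def T_term_def that by (simp add: power_add mult_ac del: of_int_add)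
  qed
  have dist: "x * (2 * u * (\<Sum>j\<in>J. f j * (\<Sum>w\<in>K j. g j w * h j w * r j w))) =
      2 * u * (\<Sum>j\<in>J. f j * (\<Sum>w\<in>K j. g j w * h j w * (x * r j w)))"
    for x u :: complex and f J and K :: "nat \<Rightarrow> nat set" and g h r
    by (simp add: sum_distrib_left mult_ac)
  show ?thesis
    unfolding \<kappa>_def[symmetric] three_pole_sum_expansion[OF pqabc(1,5,3)] distrib_left dist parity_rhs_def
    apply (intro arg_cong2[where f = "(+)"] arg_cong2[where f = "(*)"] refl sum.cong)
    subgoal using pqabc by (intro k1) auto
    subgoal using pqabc by (intro k2) auto
    subgoal using pqabc by (intro k1) auto
    subgoal using pqabc by (intro k2) auto
    done
qed

lemma has_sum_over_l:
  assumes pqabc: "p \<ge> 1" "q \<ge> 1" "a \<ge> 1" "b \<ge> 1" "c \<ge> 1" and mn: "(m, n) \<in> T_index"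
  shows "((\<lambda>l. root_term p q s a b c (l, m, n)) has_sum parity_rhs (\<lambda>p s q. T_term p s q (m, n)) p q a b c s)
     (- {0, - m, - (m + n)})"
proof -
  let ?k = "1 / (of_int m ^ q * of_int n powr s * of_int (m + n) ^ b)"
  have "((\<lambda>l. ?k * (1 / of_int (l + m) ^ a / (of_int l ^ p * of_int (l + m + n) ^ c))) has_sum
     (?k * pole_sum (of_int (m + n)) (triple_coeff (of_int m) a) (triple_coeff' (of_int n) a) p c)) (- {0, - m, - (m + n)})"
    by (intro has_sum_cmult_right has_sum_int_three_poles) (use pqabc mn in \<open>auto simp: T_index_def\<close>)
  thus ?thesis unfolding weighted_pole_sum[OF assms]
    by (rule has_sum_transform) (simp_all add: root_term_def divide_inverse mult_ac del: of_int_add)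
qed

text \<open>The chambers give an unconditional sum over all regular points, so it may be taken over
  \<open>l\<close> first; uniqueness of the remaining sum over \<open>(m, n)\<close> is the
  identity.\<close>

lemma parity_half_plane:
  assumes pqabc: "p \<ge> 1" "q \<ge> 1" "a \<ge> 1" "b \<ge> 1" "c \<ge> 1" and s: "Re s > 1"
    and F: "\<And>k z. (k, z) \<in> set (S_terms p q a b c s) \<Longrightarrow> (A3_term z has_sum F z) ({1..} \<times> {1..} \<times> {1..})"
  shows "S_sum F p q a b c s = parity_rhs (\<lambda>p s q. T_sum p s q 1 1) p q a b c s"
proof -
  have "(root_term p q s a b c has_sum S_sum F p q a b c s) regular_points"
    by (rule has_sum_root_term[OF F])
  also have "?this \<longleftrightarrow> ((\<lambda>((m, n), l). root_term p q s a b c (l, m, n)) has_sum S_sum F p q a b c s)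
      (Sigma T_index (\<lambda>(m, n). - {0, - m, - (m + n)}))"
    by (rule has_sum_reindex_bij_witness[of _ "\<lambda>((m, n), l). (l, m, n)" "\<lambda>(l, m, n). ((m, n), l)"])
       (auto simp: regular_points_def T_index_def)
  finally have "((\<lambda>x. parity_rhs (\<lambda>p s q. T_term p s q x) p q a b c s) has_sum S_sum F p q a b c s) T_index"
    by (rule has_sum_SigmaD) (use has_sum_over_l[OF pqabc] in auto)
  thus ?thesis using has_sum_parity_rhs[OF assms(1-6)] has_sum_unique by blast
qed

section \<open>Analytic continuation in s\<close>

lemma exhaust_6: "x = 1 \<or> x = 2 \<or> x = 3 \<or> x = 4 \<or> x = 5 \<or> x = 6" for x :: 6
proof (induct x)
  case (of_int z)
  then have "z = 0 \<or> z = 1 \<or> z = 2 \<or> z = 3 \<or> z = 4 \<or> z = 5" by fastforce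
  then show ?case by auto
qed

lemma forall_6: "(\<forall>i::6. P i) \<longleftrightarrow> P 1 \<and> P 2 \<and> P 3 \<and> P 4 \<and> P 5 \<and> P 6"
  by (metis exhaust_6)

text \<open>Each argument vector is affine in \<open>u\<close>, so its values at 0 and 1 determine
  the line along which it moves.\<close>

lemma S_terms_affine:
  "S_terms p q a b c u = map2 (\<lambda>(k, x) (_, y). (k, x + u *s (y - x))) (S_terms p q a b c 0) (S_terms p q a b c 1)"
  by (simp add: S_terms_def Let_def vec_eq_iff forall_6)

lemma Re_S_terms:
  assumes "p \<ge> 1" "q \<ge> 1" "a \<ge> 1" "b \<ge> 1" "c \<ge> 1" "Re u > 1" "(k, z) \<in> set (S_terms p q a b c u)"
  shows "Re (vec_nth z i) \<ge> 1"
proof -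
  have "\<forall>i. Re (vec_nth z i) \<ge> 1"
    using assms(7,1-6) by (auto simp: S_terms_def Let_def forall_6)
  thus ?thesis by blast
qed

text \<open>Real parts of at least 1 stay above 3/4 nearby, so \<open>F\<close> agrees with the
  series on a neighbourhood and inherits its continuity.\<close>

lemma isCont_continuation:
  assumes "zeta3_A3_continuation F" and z: "\<And>i. Re (vec_nth z i) \<ge> 1"
  shows "isCont F z" "(A3_term z has_sum F z) ({1..} \<times> {1..} \<times> {1..})"
proof -
  have F: "F z = (\<Sum>\<^sub>\<infinity>x\<in>{1..} \<times> {1..} \<times> {1..}. A3_term z x)" if "\<forall>i. Re (vec_nth z i) > 3/4" for z
    using assms(1) A3_term_abs_summable[of z] that by (auto simp: zeta3_A3_continuation_def less_imp_le)
  have z': "Re (vec_nth z i) > 3/4" for i using z[of i] by simp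
  have "\<forall>\<^sub>F w in nhds z. \<forall>i. Re (vec_nth w i) > 3/4"
  proof (rule eventually_all_finite)
    fix i
    have "open {w :: complex ^ 6. Re (vec_nth w i) > 3/4}"
      by (intro open_Collect_less continuous_intros)
    thus "\<forall>\<^sub>F w in nhds z. Re (vec_nth w i) > 3/4"
      using z'[of i] eventually_nhds_in_open by force
  qed
  hence "\<forall>\<^sub>F w in nhds z. F w = (\<Sum>\<^sub>\<infinity>x\<in>{1..} \<times> {1..} \<times> {1..}. A3_term w x)"
    by eventually_elim (use F in blast)
  thus "isCont F z" using isCont_A3_sum[OF z'] by (subst isCont_cong)
  show "(A3_term z has_sum F z) ({1..} \<times> {1..} \<times> {1..})"
    using has_sum_infsum[OF abs_summable_summable[OF A3_term_abs_summable]] z' F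
    by (simp add: less_imp_le)
qed

text \<open>Values at poles are arbitrary, so the identity theorem is applied to
  \<open>remove_sings d\<close>; analyticity at \<open>s\<close> ensures that the value there is
  unchanged.\<close>

lemma meromorphic_eq_0:
  assumes "d meromorphic_on UNIV" "d analytic_on {s}" "open U" "U \<noteq> {}" "\<And>u. u \<in> U \<Longrightarrow> d u = 0"
  shows "d s = 0"
proof -
  obtain u0 where u0: "u0 \<in> U" using assms by blast
  have "\<forall>\<^sub>F u in at u0. u \<in> U - {u0}" by (rule eventually_at_in_open) (use assms u0 in auto)
  hence "\<forall>\<^sub>F u in at u0. remove_sings d u = 0"
  proof eventually_elim
    case (elim u)
    have "(\<lambda>_. 0) holomorphic_on U" by simp
    hence "d holomorphic_on U" by (rule holomorphic_transform) (use assms in auto)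
    hence "d analytic_on {u}" using elim assms by (auto simp: analytic_at)
    thus ?case using elim assms by simp
  qed
  hence "\<exists>\<^sub>F u in at u0. remove_sings d u = 0" by (rule eventually_frequently[rotated]) simp
  hence "remove_sings d s = 0"
    by (rule frequently_eq_meromorphic_imp_constant[where A = UNIV])
       (use assms remove_sings_nicely_meromorphic in auto)
  thus ?thesis using assms(2) by simp
qed

text \<open>Near \<open>s\<close> the function on the line is a slice of the analytic function
  \<open>F\<close>, hence analytic there with the right value; for \<open>Re u > 1\<close> the
  comparison rests on the continuity of the series.\<close>

lemma continuation_on_line:
  fixes F :: "complex ^ 6 \<Rightarrow> complex"
  assumes "zeta3_A3_continuation F" and "cvec_analytic_at F (x + s *s e)"
    and re: "\<And>u i. Re u > 1 \<Longrightarrow> Re (vec_nth (x + u *s e) i) \<ge> 1"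
  shows "\<exists>f. f meromorphic_on UNIV \<and> f analytic_on {s} \<and> f s = F (x + s *s e) \<and>
    (\<forall>u. Re u > 1 \<longrightarrow> f u = F (x + u *s e))"
proof -
  have cont: "isCont F (x + u *s e)" if "u \<in> {u. Re u > 1}" for u
    using isCont_continuation(1)[OF assms(1) re] that by auto
  have mero: "cvec_meromorphic F" using assms(1) by (simp add: zeta3_A3_continuation_def)
  have "open {u. Re u > 1}" by (simp add: open_halfspace_Re_gt)
  moreover have "{u. Re u > 1} \<noteq> {}" using exI[of "\<lambda>u. Re u > 1" 2] by auto
  ultimately obtain f where f: "f meromorphic_on UNIV"
    "\<And>u. isCont F (x + u *s e) \<Longrightarrow> f u = F (x + u *s e)"
    using cvec_meromorphic_restrict_line[OF mero _ _ cont] by blast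
  obtain r where r: "r > 0" "cvec_holomorphic_on F (ball (x + s *s e) r)"
    using assms(2) by (auto simp: cvec_analytic_at_def)
  define V where "V = (\<lambda>u. x + u *s e) -` ball (x + s *s e) r"
  have V: "open V" unfolding V_def
    by (intro open_vimage continuous_at_imp_continuous_on ballI continuous_intros
        linear_continuous_at bounded_linear_vector_scalar_mult) auto
  have sV: "s \<in> V" using r by (simp add: V_def)
  have fV: "f u = F (x + u *s e)" if "u \<in> V" for u
    using f(2) cvec_holomorphic_on_imp_isCont[OF r(2)] that by (simp add: V_def)
  have "(\<lambda>u. F (x + u *s e)) holomorphic_on V"
    by (rule cvec_holomorphic_on_line[OF r(2)]) (simp add: V_def)
  hence "f holomorphic_on V" by (rule holomorphic_transform) (simp add: fV)
  hence "f analytic_on {s}" using V sV by (auto simp: analytic_at)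
  thus ?thesis using f cont fV[OF sV] by auto
qed

theorem theorem5p2:
  fixes F\<^sub>0 :: "complex ^ 6 \<Rightarrow> complex"
    and T :: "nat \<Rightarrow> complex \<Rightarrow> nat \<Rightarrow> complex \<Rightarrow> complex \<Rightarrow> complex"
    and p q a b c :: nat
    and s :: complex
  assumes "zeta3_A3_continuation F\<^sub>0"
    and "T_continuation T 1 1"
    and "p \<ge> 1" and "q \<ge> 1" and "a \<ge> 1" and "b \<ge> 1" and "c \<ge> 1"
    and "\<And>k z. (k, z) \<in> set (S_terms p q a b c s) \<Longrightarrow> cvec_analytic_at F\<^sub>0 z"
    and "\<And>j \<omega>. j \<le> p div 2 \<Longrightarrow> \<omega> \<le> p - 2 * j \<Longrightarrow>
           (\<lambda>u. T (q + a + \<omega>) u (p + b + c - 2 * j - \<omega>) 1 1) analytic_on {s}"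
    and "\<And>j \<omega>. j \<le> c div 2 \<Longrightarrow> \<omega> \<le> c - 2 * j \<Longrightarrow>
           (\<lambda>u. T q (u + of_nat (a + \<omega>)) (p + b + c - 2 * j - \<omega>) 1 1) analytic_on {s}"
    and "\<And>j \<omega>. j \<le> a div 2 \<Longrightarrow> \<omega> \<le> p - 1 \<Longrightarrow>
           (\<lambda>u. T (q + a - 2 * j + \<omega> + 1) u (p + b + c - 1 - \<omega>) 1 1) analytic_on {s}"
    and "\<And>j \<omega>. j \<le> a div 2 \<Longrightarrow> \<omega> \<le> c - 1 \<Longrightarrow>
           (\<lambda>u. T q (u + of_nat (a - 2 * j + \<omega> + 1)) (p + b + c - \<omega> - 1) 1 1) analytic_on {s}"
  shows "S_sum F\<^sub>0 p q a b c s =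
      2 * (-1) ^ p * (\<Sum>j=0..p div 2. riemann_zeta (of_nat (2 * j)) *
        (\<Sum>\<omega>=0..p - 2 * j.
           of_nat ((\<omega> + a - 1) choose \<omega>) *
           of_nat ((p + c - 2 * j - \<omega> - 1) choose (c - 1)) *
           T (q + a + \<omega>) s (p + b + c - 2 * j - \<omega>) 1 1))
    + 2 * (-1) ^ (p + a) * (\<Sum>j=0..c div 2. riemann_zeta (of_nat (2 * j)) *
        (\<Sum>\<omega>=0..c - 2 * j.
           of_nat ((\<omega> + a - 1) choose \<omega>) *
           of_nat ((p + c - 2 * j - \<omega> - 1) choose (p - 1)) *
           T q (s + of_nat (a + \<omega>)) (p + b + c - 2 * j - \<omega>) 1 1))
    + 2 * (-1) ^ p * (\<Sum>j=0..a div 2. riemann_zeta (of_nat (2 * j)) *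
        (\<Sum>\<omega>=0..p - 1.
           of_nat ((\<omega> + a - 2 * j) choose \<omega>) *
           of_nat ((p + c - 2 - \<omega>) choose (c - 1)) *
           T (q + a - 2 * j + \<omega> + 1) s (p + b + c - 1 - \<omega>) 1 1))
    + 2 * (-1) ^ (p + a) * (\<Sum>j=0..a div 2. riemann_zeta (of_nat (2 * j)) *
        (\<Sum>\<omega>=0..c - 1.
           of_nat ((\<omega> + a - 2 * j) choose \<omega>) *
           of_nat ((p + c - 2 - \<omega>) choose (p - 1)) *
           T q (s + of_nat (a - 2 * j + \<omega> + 1)) (p + b + c - \<omega> - 1) 1 1))"
proof -
  note F = assms(1) and T = assms(2) and pqabc = assms(3-7) and F_analytic = assms(8)
  define \<tau> where "\<tau> p s q = T p s q 1 1" for p s q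
  define L where "L = zip (S_terms p q a b c 0) (S_terms p q a b c 1)"
  define lineat where "lineat w u = snd (fst w) + u *s (snd (snd w) - snd (fst w))"
    for w :: "(nat \<times> (complex ^ 6)) \<times> (nat \<times> (complex ^ 6))" and u
  have L: "S_terms p q a b c u = map (\<lambda>w. (fst (fst w), lineat w u)) L" for u
    by (subst S_terms_affine) (simp add: L_def lineat_def case_prod_unfold)
  have "\<forall>w\<in>set L. \<exists>f. f meromorphic_on UNIV \<and> f analytic_on {s} \<and> f s = F\<^sub>0 (lineat w s) \<and>
      (\<forall>u. Re u > 1 \<longrightarrow> f u = F\<^sub>0 (lineat w u))"
  proof
    fix w assume w: "w \<in> set L"
    hence mem: "(fst (fst w), lineat w u) \<in> set (S_terms p q a b c u)" for u
      unfolding L by auto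
    show "\<exists>f. f meromorphic_on UNIV \<and> f analytic_on {s} \<and> f s = F\<^sub>0 (lineat w s) \<and>
      (\<forall>u. Re u > 1 \<longrightarrow> f u = F\<^sub>0 (lineat w u))"
      using F_analytic[OF mem] Re_S_terms[OF pqabc _ mem] unfolding lineat_def
      by (intro continuation_on_line[OF F]) auto
  qed
  from bchoice[OF this] obtain f where f: "\<And>w. w \<in> set L \<Longrightarrow> f w meromorphic_on UNIV" "\<And>w. w \<in> set L \<Longrightarrow> f w analytic_on {s}"
    "\<And>w. w \<in> set L \<Longrightarrow> f w s = F\<^sub>0 (lineat w s)"
    "\<And>w u. w \<in> set L \<Longrightarrow> Re u > 1 \<Longrightarrow> f w u = F\<^sub>0 (lineat w u)"
    by blast
  \<comment> \<open>\<open>S_sum\<close> need not be meromorphic in \<open>u\<close>, as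
    \<open>F\<^sub>0\<close> may take arbitrary values at singularities. \<open>M\<close> is, and
    agrees with it at \<open>s\<close> and for \<open>Re u > 1\<close>.\<close>
  define M where "M u = (\<Sum>w\<leftarrow>L. (-1) ^ fst (fst w) * f w u)" for u
  have S_sum_L: "S_sum F\<^sub>0 p q a b c u = (\<Sum>w\<leftarrow>L. (-1) ^ fst (fst w) * F\<^sub>0 (lineat w u))" for u
    unfolding S_sum_def L by (simp add: o_def)
  have M: "M s = S_sum F\<^sub>0 p q a b c s" "\<And>u. Re u > 1 \<Longrightarrow> M u = S_sum F\<^sub>0 p q a b c u"
    unfolding M_def S_sum_L using f(3,4) by (auto intro!: arg_cong[of _ _ sum_list] map_cong)
  have T_mero: "(\<lambda>u. \<tau> i u k) meromorphic_on UNIV" if "i \<ge> 1" "k \<ge> 1" for i k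
    using T that by (auto simp: T_continuation_def \<tau>_def)
  have T_shift: "(\<lambda>u. \<tau> i (u + of_nat r) k) meromorphic_on UNIV" if "i \<ge> 1" "k \<ge> 1" for i k r
    using T_mero[OF that] by (rule meromorphic_on_compose) (auto intro!: analytic_intros)
  have T_eq: "\<tau> i u k = T_sum i u k 1 1" if "i \<ge> 1" "k \<ge> 1" "Re u > 1" for i k u
    using T that by (auto simp: T_continuation_def \<tau>_def)
  have half_plane: "M u = parity_rhs \<tau> p q a b c u" if u: "Re u > 1" for u
  proof -
    have "M u = S_sum F\<^sub>0 p q a b c u" by (rule M(2)[OF u])
    also have "\<dots> = parity_rhs (\<lambda>p s q. T_sum p s q 1 1) p q a b c u"
      by (rule parity_half_plane[OF pqabc u] isCont_continuation(2)[OF F] Re_S_terms[OF pqabc u])+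
    also have "\<dots> = parity_rhs \<tau> p q a b c u"
      unfolding parity_rhs_def
      by (intro arg_cong2[where f = "(+)"] arg_cong2[where f = "(*)"] refl sum.cong T_eq[symmetric])
         (use pqabc u in \<open>auto intro: add_pos_nonneg\<close>)
    finally show ?thesis .
  qed
  have "(\<lambda>u. M u - parity_rhs \<tau> p q a b c u) meromorphic_on UNIV"
    unfolding M_def parity_rhs_def
    by (intro meromorphic_intros T_mero T_shift f) (use pqabc in auto)
  moreover have "(\<lambda>u. M u - parity_rhs \<tau> p q a b c u) analytic_on {s}"
  proof (intro analytic_on_diff)
    have "(\<lambda>u. \<Sum>w\<leftarrow>K. (-1) ^ fst (fst w) * f w u) analytic_on {s}" if "set K \<subseteq> set L" for K
      using that by (induction K) (auto intro!: analytic_intros f)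
    thus "M analytic_on {s}" unfolding M_def by simp
    show "parity_rhs \<tau> p q a b c analytic_on {s}"
      unfolding parity_rhs_def[abs_def] \<tau>_def by (intro analytic_intros assms) auto
  qed
  ultimately have "M s - parity_rhs \<tau> p q a b c s = 0"
  proof (rule meromorphic_eq_0)
    show "open {u. Re u > 1}" by (simp add: open_halfspace_Re_gt)
    show "{u. Re u > 1} \<noteq> {}" using exI[of "\<lambda>u. Re u > 1" 2] by auto
  qed (use half_plane in auto)
  thus ?thesis unfolding M(1) parity_rhs_def \<tau>_def by simp
qed

end
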